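(* Let $k$ be a positive integer. There exists an integer $n_0$ such that if $n \geq \max\{(80k)^2, n_0\}$ and $G$ is an $n$-vertex graph not containing $C_n^k$ as a subgraph, then $\lambda(G) \leq \lambda(H_{n,2k})$, with equality if and only if $G \cong H_{n,2k}$.
   Context: All graphs are finite and simple. $\lambda(G)$ denotes the largest eigenvalue of the adjacency matrix of $G$. $C_n^k$ is the $k$-th power of the $n$-vertex cycle $C_n$: the graph on $V(C_n)$ in which two vertices are adjacent iff their distance in $C_n$ is at most $k$. For integers $n>m\geq 1$, $H_{n,m} = K_{m-1} \vee (K_{n-m} \cup K_1)$, i.e. an $(n-1)$-clique plus one vertex adjacent to exactly $m-1$ vertices of the clique. *)

theory Defs
  imports "Jordan_Normal_Form.Char_Poly"
begin

definition simple_graph :: "nat \<Rightarrow> (nat \<Rightarrow> nat \<Rightarrow> bool) \<Rightarrow> bool" where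
  "simple_graph n E \<longleftrightarrow> (\<forall>i j. E i j \<longrightarrow> i < n \<and> j < n \<and> i \<noteq> j \<and> E j i)"

definition adj_matrix :: "nat \<Rightarrow> (nat \<Rightarrow> nat \<Rightarrow> bool) \<Rightarrow> real mat" where
  "adj_matrix n E = mat n n (\<lambda>(i, j). if E i j then 1 else 0)"

definition spec_rad :: "nat \<Rightarrow> (nat \<Rightarrow> nat \<Rightarrow> bool) \<Rightarrow> real" where
  "spec_rad n E = Max {\<mu>. eigenvalue (adj_matrix n E) \<mu>}"

definition cycle_power :: "nat \<Rightarrow> nat \<Rightarrow> nat \<Rightarrow> nat \<Rightarrow> bool" where
  "cycle_power n k i j \<longleftrightarrow> i < n \<and> j < n \<and> i \<noteq> j \<and>
     min (if i \<le> j then j - i else i - j) (n - (if i \<le> j then j - i else i - j)) \<le> k"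

text \<open>H_{n,m}: clique on {0..<n-1}, plus vertex n-1 adjacent exactly to 0..m-2.\<close>
definition H_graph :: "nat \<Rightarrow> nat \<Rightarrow> nat \<Rightarrow> nat \<Rightarrow> bool" where
  "H_graph n m i j \<longleftrightarrow> i < n \<and> j < n \<and> i \<noteq> j \<and>
     ((i < n - 1 \<and> j < n - 1) \<or> min i j < m - 1)"

definition contains_subgraph ::
  "nat \<Rightarrow> (nat \<Rightarrow> nat \<Rightarrow> bool) \<Rightarrow> nat \<Rightarrow> (nat \<Rightarrow> nat \<Rightarrow> bool) \<Rightarrow> bool" where
  "contains_subgraph n G m H \<longleftrightarrow> (\<exists>f. inj_on f {0..<m} \<and> f ` {0..<m} \<subseteq> {0..<n} \<and>
      (\<forall>i<m. \<forall>j<m. H i j \<longrightarrow> G (f i) (f j)))"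

definition graph_iso :: "nat \<Rightarrow> (nat \<Rightarrow> nat \<Rightarrow> bool) \<Rightarrow> (nat \<Rightarrow> nat \<Rightarrow> bool) \<Rightarrow> bool" where
  "graph_iso n G H \<longleftrightarrow> (\<exists>f. bij_betw f {0..<n} {0..<n} \<and>
      (\<forall>i<n. \<forall>j<n. G i j \<longleftrightarrow> H (f i) (f j)))"

end

theory Submission
  imports Defs "Jordan_Normal_Form.Spectral_Radius" "HOL-Analysis.Function_Topology"
    "HOL-Combinatorics.Transposition"
begin

text \<open>Since \<open>H = H_graph n (2 * k)\<close> contains a clique on \<open>n - 1\<close> vertices, a competitor \<open>G\<close> has
  spectral radius at least \<open>n - 2\<close>. Its Perron vector then shows that the complement has \<open>O(n)\<close>
  edges, that only \<open>O(d)\<close> of them avoid a given vertex of degree \<open>d\<close>, and that none do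
  if \<open>d\<^sup>2 < n - 2\<close>. If some degree is less than \<open>2 k\<close>, then \<open>G\<close> is a spanning subgraph of \<open>H\<close> and strict
  monotonicity of the spectral radius applies. Otherwise the \<open>k\<close>-th power of the cycle embeds: the few
  vertices of large degree in the complement are placed first, each in the middle of a clique
  of \<open>2 k + 1\<close> consecutive vertices, and the rest is packed by the exchange argument of
  Sauer and Spencer.\<close>

section \<open>The spectral radius as a Rayleigh quotient\<close>

text \<open>The exchange argument needs the product of the maximum degrees of the two graphs to be
  small compared with n, but a complement with O(n) edges may still have vertices of degree close to
  n. Such a vertex is harmless once every position within distance k of its own is fixed along with
  it: no conflict can then join it to a free position. This costs a clique inside its neighbourhood.
  A neighbourhood of size d supplies one because only O(d) edges of the complement avoid the vertex,
  so the average complement degree there is bounded by an absolute constant. There are O(k) such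
  vertices, each consuming 2k others, so the greedy choice works once d is a large multiple of k^2.
  Below that threshold the condition that the square of d is less than n - 2 is available instead;
  with d of order k^2 it forces a bound on n of order k^4.\<close>

definition quad_form :: "nat \<Rightarrow> (nat \<Rightarrow> nat \<Rightarrow> bool) \<Rightarrow> (nat \<Rightarrow> real) \<Rightarrow> real" where
  "quad_form n E x = (\<Sum>i<n. \<Sum>j<n. of_bool (E i j) * x i * x j)"

lemma compact_box:
  fixes K :: "'i \<Rightarrow> real set"
  assumes "\<And>i. compact (K i)"
  shows "compact (PiE UNIV K)"
proof -
  have "compactin (product_topology (\<lambda>i. euclidean) UNIV) (PiE UNIV K)"
    using assms by (subst compactin_PiE) auto
  then show ?thesis
    by (simp add: euclidean_product_topology)
qed

lemma quad_form_scale: "quad_form n E (\<lambda>i. c * x i) = c\<^sup>2 * quad_form n E x"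
  by (simp add: quad_form_def sum_distrib_left power2_eq_square algebra_simps)

text \<open>Passing to absolute values does not decrease the form, so its maximum over the
  nonnegative part of the unit sphere bounds it on all vectors. Compactness thus yields a
  nonnegative maximiser without Perron-Frobenius theory.\<close>

lemma quad_form_maximiser:
  assumes "n > 0"
  obtains x where "\<And>i. 0 \<le> x i" "(\<Sum>i<n. (x i)\<^sup>2) = 1"
    "\<And>y. quad_form n E y \<le> quad_form n E x * (\<Sum>i<n. (y i)\<^sup>2)"
proof -
  \<comment> \<open>Coordinates from \<open>n\<close> on are pinned to 0, which makes the box a
    product of compact sets although vectors are functions on all of \<open>nat\<close>.\<close>
  define S :: "(nat \<Rightarrow> real) set" where
    "S = PiE UNIV (\<lambda>i. if i < n then {0..1} else {0}) \<inter> {x. (\<Sum>i<n. (x i)\<^sup>2) = 1}"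
  have "closed {x::nat \<Rightarrow> real. (\<Sum>i<n. (x i)\<^sup>2) = 1}"
    by (intro closed_Collect_eq continuous_intros continuous_on_product_coordinates)
  then have "compact S"
    unfolding S_def by (intro compact_Int_closed compact_box) auto
  moreover have "(\<lambda>i. if i = 0 then 1 else 0) \<in> S"
    using assms by (auto simp: S_def if_distrib[of "\<lambda>x. x\<^sup>2"] cong: if_cong)
  then have "S \<noteq> {}" by blast
  moreover have "continuous_on S (quad_form n E)"
    unfolding quad_form_def
    by (intro continuous_intros continuous_on_subset[OF continuous_on_product_coordinates]) auto
  ultimately obtain x where x: "x \<in> S" "\<And>y. y \<in> S \<Longrightarrow> quad_form n E y \<le> quad_form n E x"
    using continuous_attains_sup by metis
  show thesis
  proof
    show "0 \<le> x i" for i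
    proof -
      have "x i \<in> (if i < n then {0..1} else {0})"
        using x(1) unfolding S_def by blast
      then show ?thesis by (auto split: if_splits)
    qed
    show "(\<Sum>i<n. (x i)\<^sup>2) = 1" using x(1) by (simp add: S_def)
    fix y :: "nat \<Rightarrow> real"
    define N where "N = (\<Sum>i<n. (y i)\<^sup>2)"
    show "quad_form n E y \<le> quad_form n E x * (\<Sum>i<n. (y i)\<^sup>2)"
    proof (cases "N = 0")
      case True
      then have "\<forall>i<n. y i = 0"
        unfolding N_def by (subst (asm) sum_nonneg_eq_0_iff) auto
      then have "quad_form n E y = 0" by (simp add: quad_form_def)
      then show ?thesis using True by (simp add: N_def)
    next
      case False
      then have N: "N > 0" unfolding N_def by (simp add: order_less_le sum_nonneg)
      define z where "z i = (if i < n then inverse (sqrt N) * \<bar>y i\<bar> else 0)" for i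
      have z2: "(\<Sum>i<n. (z i)\<^sup>2) = 1"
      proof -
        have "(\<Sum>i<n. (z i)\<^sup>2) = (\<Sum>i<n. inverse N * (y i)\<^sup>2)"
          using N by (intro sum.cong) (auto simp: z_def power_mult_distrib power_inverse)
        also have "\<dots> = inverse N * N" by (simp add: N_def sum_distrib_left)
        finally show ?thesis using N by simp
      qed
      have "z i \<le> 1" for i
      proof (cases "i < n")
        case True
        then have "(z i)\<^sup>2 \<le> (\<Sum>i<n. (z i)\<^sup>2)" by (intro member_le_sum) auto
        then show ?thesis using z2 by (simp add: abs_square_le_1 abs_le_iff)
      qed (simp add: z_def)
      moreover have "0 \<le> z i" for i using N by (simp add: z_def)
      ultimately have "z \<in> S"
        using z2 by (auto simp: S_def PiE_iff) (auto simp: z_def)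
      from x(2)[OF this] have "quad_form n E z \<le> quad_form n E x" .
      moreover have "quad_form n E z = inverse N * quad_form n E (\<lambda>i. \<bar>y i\<bar>)"
      proof -
        have "quad_form n E z = quad_form n E (\<lambda>i. inverse (sqrt N) * \<bar>y i\<bar>)"
          unfolding quad_form_def by (intro sum.cong) (auto simp: z_def)
        then show ?thesis using N by (simp only: quad_form_scale) (simp add: power_inverse)
      qed
      moreover have "quad_form n E y \<le> quad_form n E (\<lambda>i. \<bar>y i\<bar>)"
        unfolding quad_form_def
        by (intro sum_mono) (auto simp: abs_mult[symmetric])
      ultimately show ?thesis using N unfolding N_def[symmetric]
        by (simp add: field_simps)
    qed
  qed
qed

lemma linear_coeff_zero:
  fixes b c :: real
  assumes "\<And>t. 0 \<le> c * t\<^sup>2 + 2 * b * t"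
  shows "b = 0"
proof (rule ccontr)
  assume b: "b \<noteq> 0"
  \<comment> \<open>This choice gives \<open>c * e < 1\<close>, so at \<open>t = - (b * e)\<close>
    the quadratic is negative.\<close>
  define e where "e = 1 / (\<bar>c\<bar> + 1)"
  have e: "e > 0" "c * e < 1" by (auto simp: e_def field_simps add_pos_nonneg abs_if)
  have "0 \<le> c * (- (b * e))\<^sup>2 + 2 * b * (- (b * e))" by (rule assms)
  also have "\<dots> = b\<^sup>2 * e * (c * e - 2)" by (simp add: power2_eq_square algebra_simps)
  also have "\<dots> < 0" using b e by (intro mult_pos_neg) auto
  finally show False by simp
qed

text \<open>The difference of the two sides of \<open>bound\<close> is nonnegative and vanishes at
  \<open>x\<close>, so its derivative there in the direction of coordinate \<open>i\<close> is zero;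
  half of this derivative is \<open>M * x i\<close> minus the sum in the conclusion.\<close>

lemma quad_form_maximiser_eigen:
  assumes sym: "\<And>i j. E i j \<Longrightarrow> E j i"
    and bound: "\<And>y. quad_form n E y \<le> M * (\<Sum>i<n. (y i)\<^sup>2)"
    and eq: "quad_form n E x = M * (\<Sum>i<n. (x i)\<^sup>2)"
    and i: "i < n"
  shows "(\<Sum>j<n. of_bool (E i j) * x j) = M * x i"
proof -
  define R where "R = (\<Sum>j<n. of_bool (E i j) * x j)"
  define d :: "nat \<Rightarrow> real" where "d j = of_bool (j = i)" for j
  have d: "(\<Sum>j<n. f j * d j) = f i" for f
    using i by (simp add: d_def of_bool_def if_distrib cong: if_cong)
  have d': "(\<Sum>j<n. d j * f j) = f i" for f
    using d[of f] by (simp add: mult.commute)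
  have dd: "d j * d j = d j" for j by (simp add: d_def)
  have "0 \<le> (M - of_bool (E i i)) * t\<^sup>2 + 2 * (M * x i - R) * t" for t
  proof -
    have n2: "(\<Sum>j<n. (x j + t * d j)\<^sup>2) = (\<Sum>j<n. (x j)\<^sup>2) + 2 * t * x i + t\<^sup>2"
    proof -
      have "(\<Sum>j<n. (x j + t * d j)\<^sup>2) = (\<Sum>j<n. (x j)\<^sup>2 + 2 * t * (x j * d j) + t\<^sup>2 * d j)"
        by (intro sum.cong refl) (auto simp: d_def power2_eq_square algebra_simps)
      also have "\<dots> = (\<Sum>j<n. (x j)\<^sup>2) + 2 * t * x i + t\<^sup>2"
        using d[of "\<lambda>_. 1"] by (simp only: sum.distrib sum_distrib_left[symmetric] d) simp
      finally show ?thesis .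
    qed
    have E1: "(\<Sum>a<n. \<Sum>b<n. of_bool (E a b) * x a * d b) = R"
    proof -
      have "of_bool (E a i) = (of_bool (E i a) :: real)" for a using sym by (auto simp: of_bool_def)
      then show ?thesis by (simp only: d R_def)
    qed
    have E2: "(\<Sum>a<n. \<Sum>b<n. of_bool (E a b) * d a * x b) = R"
    proof -
      have "(\<Sum>a<n. \<Sum>b<n. of_bool (E a b) * d a * x b) = (\<Sum>a<n. d a * (\<Sum>b<n. of_bool (E a b) * x b))"
        unfolding sum_distrib_left by (intro sum.cong refl) (simp only: mult_ac)
      then show ?thesis by (simp add: d' R_def)
    qed
    have E3: "(\<Sum>a<n. \<Sum>b<n. of_bool (E a b) * d a * d b) = of_bool (E i i)"
      by (simp add: d)
    have "quad_form n E (\<lambda>j. x j + t * d j) = (\<Sum>a<n. \<Sum>b<n. of_bool (E a b) * x a * x b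
        + t * (of_bool (E a b) * x a * d b) + t * (of_bool (E a b) * d a * x b)
        + t\<^sup>2 * (of_bool (E a b) * d a * d b))"
      unfolding quad_form_def by (intro sum.cong refl) (simp add: power2_eq_square algebra_simps)
    also have "\<dots> = quad_form n E x + 2 * t * R + t\<^sup>2 * of_bool (E i i)"
      by (simp only: sum.distrib sum_distrib_left[symmetric] E1 E2 E3 quad_form_def)
    finally have "quad_form n E x + 2 * t * R + t\<^sup>2 * of_bool (E i i)
        \<le> M * ((\<Sum>j<n. (x j)\<^sup>2) + 2 * t * x i + t\<^sup>2)"
      using bound[of "\<lambda>j. x j + t * d j"] n2 by simp
    then show ?thesis using eq by (simp add: algebra_simps)
  qed
  then have "M * x i - R = 0" by (rule linear_coeff_zero)
  then show ?thesis by (simp add: R_def)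
qed

lemma quad_form_eigen:
  assumes "\<And>i. i < n \<Longrightarrow> (\<Sum>j<n. of_bool (E i j) * x j) = M * x i"
  shows "quad_form n E x = M * (\<Sum>i<n. (x i)\<^sup>2)"
proof -
  have "quad_form n E x = (\<Sum>i<n. x i * (\<Sum>j<n. of_bool (E i j) * x j))"
    unfolding quad_form_def sum_distrib_left by (intro sum.cong refl) (simp only: mult_ac)
  also have "\<dots> = (\<Sum>i<n. M * (x i)\<^sup>2)"
    using assms by (intro sum.cong) (auto simp: power2_eq_square)
  finally show ?thesis by (simp add: sum_distrib_left)
qed

section \<open>From maximisers of the quadratic form to eigenvalues of the matrix\<close>

lemma eigenvalue_adj_matrix_iff:
  "eigenvalue (adj_matrix n E) \<mu> \<longleftrightarrow>
    (\<exists>x. (\<exists>i<n. x i \<noteq> 0) \<and> (\<forall>i<n. (\<Sum>j<n. of_bool (E i j) * x j) = \<mu> * x i))"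
proof -
  have mv: "(adj_matrix n E *\<^sub>v v) $ i = (\<Sum>j<n. of_bool (E i j) * (v $ j))"
    if "i < n" "v \<in> carrier_vec n" for v i
    using that by (auto simp: adj_matrix_def scalar_prod_def lessThan_atLeast0 of_bool_def intro!: sum.cong)
  show ?thesis
  proof
    assume "eigenvalue (adj_matrix n E) \<mu>"
    then obtain v where v: "v \<in> carrier_vec n" "v \<noteq> 0\<^sub>v n" "adj_matrix n E *\<^sub>v v = \<mu> \<cdot>\<^sub>v v"
      unfolding eigenvalue_def eigenvector_def by (auto simp: adj_matrix_def)
    have "\<exists>i<n. v $ i \<noteq> 0"
      using v(1,2) by (metis carrier_vecD eq_vecI index_zero_vec(1,2))
    moreover have "\<forall>i<n. (\<Sum>j<n. of_bool (E i j) * (v $ j)) = \<mu> * (v $ i)"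
      using mv[OF _ v(1)] v(1,3) by (metis carrier_vecD index_smult_vec(1))
    ultimately show "\<exists>x. (\<exists>i<n. x i \<noteq> 0) \<and> (\<forall>i<n. (\<Sum>j<n. of_bool (E i j) * x j) = \<mu> * x i)"
      by blast
  next
    assume "\<exists>x. (\<exists>i<n. x i \<noteq> 0) \<and> (\<forall>i<n. (\<Sum>j<n. of_bool (E i j) * x j) = \<mu> * x i)"
    then obtain x where x: "\<exists>i<n. x i \<noteq> 0" "\<forall>i<n. (\<Sum>j<n. of_bool (E i j) * x j) = \<mu> * x i"
      by blast
    have "vec n x \<noteq> 0\<^sub>v n" using x(1) by (metis index_vec index_zero_vec(1))
    moreover have "adj_matrix n E *\<^sub>v vec n x = \<mu> \<cdot>\<^sub>v vec n x"
      using x(2) by (intro eq_vecI) (auto simp: mv simp del: index_mult_mat_vec, auto simp: adj_matrix_def)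
    ultimately show "eigenvalue (adj_matrix n E) \<mu>"
      unfolding eigenvalue_def eigenvector_def
      by (intro exI[of _ "vec n x"]) (auto simp: adj_matrix_def)
  qed
qed

text \<open>At an eigenvector the form equals the eigenvalue times the squared norm, so no
  eigenvalue exceeds the maximum of the form, and the maximiser is itself an eigenvector for that
  maximum.\<close>

lemma spec_rad_eqI:
  assumes "n > 0" "simple_graph n E"
    and "\<And>i. 0 \<le> x i" "(\<Sum>i<n. (x i)\<^sup>2) = 1"
    and max: "\<And>y. quad_form n E y \<le> quad_form n E x * (\<Sum>i<n. (y i)\<^sup>2)"
  shows "spec_rad n E = quad_form n E x"
  unfolding spec_rad_def
proof (rule Max_eqI)
  have "finite (spectrum (adj_matrix n E))"
    using card_finite_spectrum[of "adj_matrix n E" n] by (simp add: adj_matrix_def)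
  then show "finite {\<mu>. eigenvalue (adj_matrix n E) \<mu>}"
    by (simp add: spectrum_def)
  show "y \<le> quad_form n E x" if "y \<in> {\<mu>. eigenvalue (adj_matrix n E) \<mu>}" for y
  proof -
    from that obtain z where z: "\<exists>i<n. z i \<noteq> 0" "\<forall>i<n. (\<Sum>j<n. of_bool (E i j) * z j) = y * z i"
      by (auto simp: eigenvalue_adj_matrix_iff)
    have "(\<Sum>i<n. (z i)\<^sup>2) \<noteq> 0"
      using z(1) by (subst sum_nonneg_eq_0_iff) auto
    then have "(\<Sum>i<n. (z i)\<^sup>2) > 0" by (simp add: order_less_le sum_nonneg)
    moreover have "y * (\<Sum>i<n. (z i)\<^sup>2) \<le> quad_form n E x * (\<Sum>i<n. (z i)\<^sup>2)"
      using max[of z] quad_form_eigen[of n E z y] z(2) by simp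
    ultimately show ?thesis by simp
  qed
  have "(\<Sum>j<n. of_bool (E i j) * x j) = quad_form n E x * x i" if "i < n" for i
    using assms(2,4) by (intro quad_form_maximiser_eigen max that) (auto simp: simple_graph_def)
  moreover have "\<exists>i<n. x i \<noteq> 0"
    using assms(4) by (auto intro: ccontr)
  ultimately show "quad_form n E x \<in> {\<mu>. eigenvalue (adj_matrix n E) \<mu>}"
    by (auto simp: eigenvalue_adj_matrix_iff)
qed

text \<open>Everything later uses the spectral radius only through this variational description;
  matrices do not occur again.\<close>

lemma spec_rad_maximiser:
  assumes "n > 0" "simple_graph n E"
  obtains x where "\<And>i. 0 \<le> x i" "(\<Sum>i<n. (x i)\<^sup>2) = 1" "quad_form n E x = spec_rad n E"
    "\<And>y. quad_form n E y \<le> spec_rad n E * (\<Sum>i<n. (y i)\<^sup>2)"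
  using quad_form_maximiser[OF assms(1), of E] spec_rad_eqI[OF assms] by metis

lemma simple_graphD:
  assumes "simple_graph n E" "E i j"
  shows "i < n" "j < n" "i \<noteq> j" "E j i"
  using assms by (auto simp: simple_graph_def)

section \<open>Comparing spectral radii along spanning embeddings\<close>

lemma quad_form_reindex:
  assumes "bij_betw f {0..<n} {0..<n}"
  shows "quad_form n E y = quad_form n (\<lambda>i j. E (f i) (f j)) (y \<circ> f)"
    and "(\<Sum>i<n. (y i)\<^sup>2) = (\<Sum>i<n. ((y \<circ> f) i)\<^sup>2)"
proof -
  have f: "bij_betw f {..<n} {..<n}" using assms by (simp add: lessThan_atLeast0)
  show "quad_form n E y = quad_form n (\<lambda>i j. E (f i) (f j)) (y \<circ> f)"
    unfolding quad_form_def
    by (subst sum.reindex_bij_betw[OF f, symmetric])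
       (simp add: sum.reindex_bij_betw[OF f, of "\<lambda>j. of_bool (E (f _) j) * y (f _) * y j", symmetric])
  show "(\<Sum>i<n. (y i)\<^sup>2) = (\<Sum>i<n. ((y \<circ> f) i)\<^sup>2)"
    by (subst sum.reindex_bij_betw[OF f, symmetric]) simp
qed

lemma quad_form_mono:
  assumes "\<And>i j. E i j \<Longrightarrow> E' i j" "\<And>i. 0 \<le> x i"
  shows "quad_form n E x \<le> quad_form n E' x"
  unfolding quad_form_def using assms by (intro sum_mono mult_right_mono) auto

text \<open>The maximiser for \<open>G\<close>, carried over by the inverse of \<open>f\<close>, is
  a unit test vector for \<open>H\<close> at which the form is at least
  \<open>spec_rad n G\<close>.\<close>

lemma spec_rad_mono_embedding:
  assumes "n > 0" "simple_graph n G" "simple_graph n H"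
    and f: "bij_betw f {0..<n} {0..<n}" and emb: "\<And>i j. G i j \<Longrightarrow> H (f i) (f j)"
  shows "spec_rad n G \<le> spec_rad n H"
proof -
  obtain x where x: "\<And>i. 0 \<le> x i" "(\<Sum>i<n. (x i)\<^sup>2) = 1" "quad_form n G x = spec_rad n G"
    using spec_rad_maximiser[OF assms(1,2)] by metis
  obtain z where z: "\<And>y. quad_form n H y \<le> spec_rad n H * (\<Sum>i<n. (y i)\<^sup>2)"
    using spec_rad_maximiser[OF assms(1,3)] by metis
  define y where "y = (\<lambda>j. x (inv_into {0..<n} f j))"
  have yf: "(y \<circ> f) i = x i" if "i < n" for i
    using f that by (auto simp: y_def bij_betw_def)
  have "spec_rad n G \<le> quad_form n (\<lambda>i j. H (f i) (f j)) x"
    using quad_form_mono[where E = G and E' = "\<lambda>i j. H (f i) (f j)" and x = x and n = n, OF emb x(1)]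
      x(3) by simp
  also have "\<dots> = quad_form n (\<lambda>i j. H (f i) (f j)) (y \<circ> f)"
    unfolding quad_form_def using yf by (intro sum.cong) auto
  also have "\<dots> = quad_form n H y" using quad_form_reindex(1)[OF f, of H y] by simp
  also have "\<dots> \<le> spec_rad n H * (\<Sum>i<n. (y i)\<^sup>2)" by (rule z)
  also have "(\<Sum>i<n. (y i)\<^sup>2) = (\<Sum>i<n. ((y \<circ> f) i)\<^sup>2)" by (rule quad_form_reindex(2)[OF f])
  also have "\<dots> = 1" using yf x(2) by simp
  finally show ?thesis by simp
qed

text \<open>A dominating vertex forces every nonzero nonnegative eigenvector to be positive, so that
  the Rayleigh quotient strictly decreases when an edge is removed.\<close>

lemma spec_rad_strict_mono_embedding:
  assumes "n > 0" "simple_graph n G" "simple_graph n H"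
    and f: "bij_betw f {0..<n} {0..<n}" and emb: "\<And>i j. G i j \<Longrightarrow> H (f i) (f j)"
    and le: "spec_rad n H \<le> spec_rad n G" and pos: "spec_rad n H > 0"
    and c: "c < n" "\<And>j. j < n \<Longrightarrow> j \<noteq> c \<Longrightarrow> H c j"
    and ij: "i < n" "j < n" "H (f i) (f j)"
  shows "G i j"
proof (rule ccontr)
  assume nG: "\<not> G i j"
  obtain x where x: "\<And>i. 0 \<le> x i" "(\<Sum>i<n. (x i)\<^sup>2) = 1" "quad_form n G x = spec_rad n G"
    using spec_rad_maximiser[OF assms(1,2)] by metis
  obtain z where z: "\<And>y. quad_form n H y \<le> spec_rad n H * (\<Sum>i<n. (y i)\<^sup>2)"
    using spec_rad_maximiser[OF assms(1,3)] by metis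
  define y where "y = (\<lambda>j. x (inv_into {0..<n} f j))"
  have yf: "(y \<circ> f) i = x i" if "i < n" for i
    using f that by (auto simp: y_def bij_betw_def)
  have y0: "0 \<le> y i" for i using x(1) by (simp add: y_def)
  have y1: "(\<Sum>i<n. (y i)\<^sup>2) = 1"
    using yf x(2) quad_form_reindex(2)[OF f, of y] by simp
  have qy: "quad_form n (\<lambda>i j. H (f i) (f j)) x = quad_form n H y"
    using yf quad_form_reindex(1)[OF f, of H y] unfolding quad_form_def by simp
  have "quad_form n H y \<le> spec_rad n H" using z[of y] y1 by simp
  moreover have "quad_form n G x \<le> quad_form n H y"
    using quad_form_mono[where E = G and E' = "\<lambda>i j. H (f i) (f j)" and x = x and n = n, OF emb x(1)]
      qy by simp
  \<comment> \<open>Equality holds throughout, so the transported vector \<open>y\<close> maximises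
    the form of \<open>H\<close> and is an eigenvector.\<close>
  ultimately have eq: "quad_form n H y = spec_rad n H"
      "quad_form n (\<lambda>i j. H (f i) (f j)) x = quad_form n G x"
    using le x(3) qy by linarith+
  have eig: "(\<Sum>b<n. of_bool (H a b) * y b) = spec_rad n H * y a" if "a < n" for a
    using eq(1) y1 simple_graphD(4)[OF assms(3)] that
    by (intro quad_form_maximiser_eigen z) auto
  \<comment> \<open>The eigenvalue equation at \<open>b\<close> has \<open>y a\<close> among its
    nonnegative terms, so positivity spreads along edges: from some vertex to \<open>c\<close>, and
    from \<open>c\<close> to all others.\<close>
  have edge: "y b > 0" if "a < n" "H b a" "y a > 0" for a b
  proof -
    have "b < n" using that(2) simple_graphD[OF assms(3)] by blast
    have "0 < of_bool (H b a) * y a" using that by simp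
    also have "\<dots> \<le> (\<Sum>a<n. of_bool (H b a) * y a)"
      using that(1) y0 by (intro member_le_sum) auto
    finally show ?thesis using eig[OF \<open>b < n\<close>] pos by (simp add: zero_less_mult_iff)
  qed
  obtain a where a: "a < n" "y a > 0"
  proof -
    have "\<exists>a<n. y a \<noteq> 0" using y1 by (auto intro: ccontr)
    then show ?thesis using that y0 by (metis order_less_le)
  qed
  then have yc: "y c > 0" using edge[of a c] c by (cases "a = c") auto
  have ypos: "y b > 0" if "b < n" for b
    using edge[of c b] c simple_graphD(4)[OF assms(3)] yc that by (cases "b = c") auto
  have fl: "f b < n" if "b < n" for b using f that by (auto simp: bij_betw_def)
  have xpos: "x b > 0" if "b < n" for b
    using ypos[OF fl[OF that]] yf[OF that] by simp
  have "0 = (\<Sum>a<n. \<Sum>b<n. (of_bool (H (f a) (f b)) - of_bool (G a b)) * x a * x b)"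
    using eq(2) by (simp add: quad_form_def algebra_simps sum_subtractf)
  also have "\<dots> > 0"
  proof (rule sum_pos2)
    have nonneg: "0 \<le> (of_bool (H (f a) (f b)) - of_bool (G a b)) * x a * x b" for a b
      using emb[of a b] x(1) by (auto simp: of_bool_def)
    then show "0 \<le> (\<Sum>b<n. (of_bool (H (f a) (f b)) - of_bool (G a b)) * x a * x b)" for a
      by (intro sum_nonneg)
    show "0 < (\<Sum>b<n. (of_bool (H (f i) (f b)) - of_bool (G i b)) * x i * x b)"
      using ij nG xpos nonneg by (intro sum_pos2[of _ j]) auto
  qed (use ij in auto)
  finally show False by simp
qed

lemma spec_rad_iso:
  assumes "n > 0" "simple_graph n G" "simple_graph n H" "graph_iso n G H"
  shows "spec_rad n G = spec_rad n H"
proof -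
  obtain f where f: "bij_betw f {0..<n} {0..<n}" "\<And>i j. i < n \<Longrightarrow> j < n \<Longrightarrow> G i j \<longleftrightarrow> H (f i) (f j)"
    using assms(4) unfolding graph_iso_def by metis
  define g where "g = inv_into {0..<n} f"
  have g: "bij_betw g {0..<n} {0..<n}" unfolding g_def by (rule bij_betw_inv_into[OF f(1)])
  have fg: "f (g i) = i" "g i < n" if "i < n" for i
    using that bij_betw_inv_into_right[OF f(1)] bij_betwE[OF g] by (auto simp: g_def)
  show ?thesis
  proof (rule antisym)
    show "spec_rad n G \<le> spec_rad n H"
      using f(2) simple_graphD(1,2)[OF assms(2)]
      by (intro spec_rad_mono_embedding[OF assms(1,2,3) f(1)]) blast
    show "spec_rad n H \<le> spec_rad n G"
    proof (rule spec_rad_mono_embedding[OF assms(1,3,2) g])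
      show "G (g i) (g j)" if "H i j" for i j
        using that f(2)[of "g i" "g j"] fg simple_graphD(1,2)[OF assms(3) that] by simp
    qed
  qed
qed

lemma spec_rad_eigenvector:
  assumes "n > 0" "simple_graph n G"
  obtains x z where "\<And>i. 0 \<le> x i" "\<And>i. i < n \<Longrightarrow> x i \<le> 1" "z < n" "x z = 1"
    "\<And>i. i < n \<Longrightarrow> (\<Sum>j<n. of_bool (G i j) * x j) = spec_rad n G * x i"
proof -
  obtain x where x: "\<And>i. 0 \<le> x i" "(\<Sum>i<n. (x i)\<^sup>2) = 1" "quad_form n G x = spec_rad n G"
    "\<And>y. quad_form n G y \<le> spec_rad n G * (\<Sum>i<n. (y i)\<^sup>2)"
    using spec_rad_maximiser[OF assms] by metis
  have eig: "(\<Sum>j<n. of_bool (G i j) * x j) = spec_rad n G * x i" if "i < n" for i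
    using x simple_graphD(4)[OF assms(2)] that by (intro quad_form_maximiser_eigen) auto
  define m where "m = Max (x ` {..<n})"
  have le: "x i \<le> m" if "i < n" for i using that by (auto simp: m_def)
  have "m \<in> x ` {..<n}" unfolding m_def using assms(1) by (intro Max_in) auto
  then obtain z where z: "z < n" "x z = m" by auto
  have "m > 0"
  proof -
    have "\<exists>a<n. x a \<noteq> 0" using x(2) by (auto intro: ccontr)
    then show ?thesis using le x(1) by (metis order_less_le order_less_le_trans)
  qed
  show thesis
  proof
    show "(\<Sum>j<n. of_bool (G i j) * (x j / m)) = spec_rad n G * (x i / m)" if "i < n" for i
      using eig[OF that] by (simp add: sum_divide_distrib[symmetric])
  qed (use x(1) le z \<open>m > 0\<close> in \<open>auto simp: divide_simps\<close>)
qed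

section \<open>Packing powers of cycles\<close>

lemma bij_betw_extension:
  assumes "finite S" "finite T" "card S = card T"
    and F: "F \<subseteq> S" "inj_on g F" "g ` F \<subseteq> T"
  obtains f where "bij_betw f S T" "\<And>i. i \<in> F \<Longrightarrow> f i = g i"
proof -
  have "finite F" using F(1) assms(1) by (rule finite_subset)
  then have "card (S - F) = card (T - g ` F)"
    using F assms by (simp add: card_Diff_subset card_image)
  then obtain h where h: "bij_betw h (S - F) (T - g ` F)"
    using assms finite_same_card_bij by blast
  define f where "f i = (if i \<in> F then g i else h i)" for i
  have "bij_betw f (F \<union> (S - F)) (g ` F \<union> (T - g ` F))"
  proof (rule bij_betw_combine)
    show "bij_betw f F (g ` F)"
      using F(2) by (auto simp: f_def bij_betw_def inj_on_def)
    show "bij_betw f (S - F) (T - g ` F)"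
      using h by (subst bij_betw_cong[of _ _ h]) (auto simp: f_def)
  qed auto
  moreover have "F \<union> (S - F) = S" "g ` F \<union> (T - g ` F) = T"
    using F by auto
  ultimately show thesis by (intro that[of f]) (simp_all add: f_def)
qed

text \<open>A permutation minimising the number of conflicts has none: a conflict at a free position
  is removed by exchanging its vertex with that of another free position, and the degree bounds
  leave a position for which the exchange creates no new conflict.\<close>

lemma conflict_free_bijection:
  fixes C B :: "nat \<Rightarrow> nat \<Rightarrow> bool"
  assumes symC: "\<And>i j. C i j \<Longrightarrow> C j i" and irrC: "\<And>i. \<not> C i i"
    and symB: "\<And>u w. B u w \<Longrightarrow> B w u"
    and F: "F \<subseteq> {..<n}" "inj_on g F" "g ` F \<subseteq> {..<n}"
    and degC: "\<And>i. i < n \<Longrightarrow> card {j. j < n \<and> C i j} \<le> c"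
    and conf: "\<And>i j. i \<in> F \<Longrightarrow> j \<in> F \<Longrightarrow> C i j \<Longrightarrow> \<not> B (g i) (g j)"
    and low1: "\<And>w. w < n \<Longrightarrow> w \<notin> g ` F \<Longrightarrow> card {u. u < n \<and> B w u} \<le> \<Delta>"
    and low2: "\<And>i j. i \<in> F \<Longrightarrow> j < n \<Longrightarrow> j \<notin> F \<Longrightarrow> C i j \<Longrightarrow> card {u. u < n \<and> B (g i) u} \<le> \<Delta>"
    and big: "card F + 2 * c * \<Delta> + c + 1 < n"
  obtains f where "bij_betw f {..<n} {..<n}"
    "\<And>i j. i < n \<Longrightarrow> j < n \<Longrightarrow> C i j \<Longrightarrow> \<not> B (f i) (f j)"
proof -
  define X where "X f \<longleftrightarrow> bij_betw f {..<n} {..<n} \<and> (\<forall>i\<in>F. f i = g i)" for f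
  define K where "K f = {(i, j). i < n \<and> j < n \<and> C i j \<and> B (f i) (f j)}" for f
  have finK: "finite (K f)" for f
    by (rule finite_subset[of _ "{..<n} \<times> {..<n}"]) (auto simp: K_def)
  have finF: "finite F" using F(1) finite_subset by blast
  have "\<exists>f. X f"
    using bij_betw_extension[of "{..<n}" "{..<n}" F g] F unfolding X_def by (metis finite_lessThan)
  then obtain f where f: "X f" and min: "\<And>f'. X f' \<Longrightarrow> card (K f) \<le> card (K f')"
    using ex_has_least_nat[of X _ "\<lambda>f. card (K f)"] by blast
  have bij: "bij_betw f {..<n} {..<n}" and fF: "\<And>i. i \<in> F \<Longrightarrow> f i = g i"
    using f by (auto simp: X_def)
  have fn: "f i < n" if "i < n" for i using bij that by (auto simp: bij_betw_def)
  have inj: "inj_on f {..<n}" using bij by (simp add: bij_betw_def)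
  have False if ij: "i < n" "j < n" "C i j" "B (f i) (f j)" and iF: "i \<notin> F" for i j
  proof -
    define N where "N a = {b. b < n \<and> C a b}" for a
    define D where "D u = {w. w < n \<and> B u w}" for u
    have fin: "finite (N a)" "finite (D u)" for a u by (auto simp: N_def D_def)
    \<comment> \<open>\<open>X3\<close> holds the \<open>l\<close> for which \<open>f l\<close>
      would conflict at position \<open>i\<close>, \<open>X4\<close> those for which
      \<open>f i\<close> would conflict at position \<open>l\<close>. Together with
      \<open>F\<close>, \<open>N i\<close> and \<open>i\<close> they number at most
      \<open>card F + 2 * c * \<Delta> + c + 1\<close>, so \<open>big\<close> leaves a position for
      the exchange.\<close>
    define X3 where "X3 = {l. l < n \<and> (\<exists>b\<in>N i. B (f b) (f l))}"
    define X4 where "X4 = {l. l < n \<and> (\<exists>b<n. C l b \<and> B (f i) (f b))}"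
    have free: "card (D (f b)) \<le> \<Delta>" if "b < n" "b \<notin> F" for b
    proof -
      have "f b \<notin> g ` F"
      proof
        assume "f b \<in> g ` F"
        then obtain a where "a \<in> F" "f b = f a" using fF by force
        then show False using inj that F(1) by (metis inj_onD lessThan_iff subsetD)
      qed
      then show ?thesis using low1[OF fn[OF that(1)]] by (simp add: D_def)
    qed
    have pre: "card {l. l < n \<and> f l \<in> S} \<le> card S" if "finite S" for S
      by (rule card_inj_on_le[of f]) (use that inj in \<open>auto simp: inj_on_def\<close>)
    have "X3 \<subseteq> (\<Union>b\<in>N i. {l. l < n \<and> f l \<in> D (f b)})"
      using fn by (auto simp: X3_def D_def)
    then have "card X3 \<le> card (\<Union>b\<in>N i. {l. l < n \<and> f l \<in> D (f b)})"
      by (intro card_mono) (auto simp: N_def)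
    also have "\<dots> \<le> (\<Sum>b\<in>N i. card {l. l < n \<and> f l \<in> D (f b)})"
      by (intro card_UN_le fin)
    also have "\<dots> \<le> (\<Sum>b\<in>N i. \<Delta>)"
    proof (rule sum_mono)
      fix b assume b: "b \<in> N i"
      \<comment> \<open>Here \<open>b\<close> may be a fixed position next to the free position
        \<open>i\<close>. Vertices of large degree in \<open>B\<close> are kept away from such
        positions by \<open>low2\<close>.\<close>
      have "card (D (f b)) \<le> \<Delta>"
      proof (cases "b \<in> F")
        case True
        have "C b i" using b symC by (simp add: N_def)
        then show ?thesis using low2[OF True ij(1) iF] fF[OF True] by (simp add: D_def)
      next
        case False
        then show ?thesis using free b by (simp add: N_def)
      qed
      then show "card {l. l < n \<and> f l \<in> D (f b)} \<le> \<Delta>" using pre[OF fin(2), of "f b"] by linarith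
    qed
    also have "\<dots> \<le> c * \<Delta>" using degC[OF ij(1)] by (simp add: N_def)
    finally have X3: "card X3 \<le> c * \<Delta>" .
    have "X4 \<subseteq> (\<Union>b\<in>{b. b < n \<and> f b \<in> D (f i)}. N b)"
      using symC fn by (fastforce simp: X4_def D_def N_def)
    then have "card X4 \<le> card (\<Union>b\<in>{b. b < n \<and> f b \<in> D (f i)}. N b)"
      by (intro card_mono) (auto simp: fin)
    also have "\<dots> \<le> (\<Sum>b\<in>{b. b < n \<and> f b \<in> D (f i)}. card (N b))"
      by (intro card_UN_le) auto
    also have "\<dots> \<le> (\<Sum>b\<in>{b. b < n \<and> f b \<in> D (f i)}. c)"
      using degC by (intro sum_mono) (auto simp: N_def)
    also have "\<dots> \<le> \<Delta> * c"
      using pre[OF fin(2), of "f i"] free[OF ij(1) iF] by simp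
    finally have X4: "card X4 \<le> \<Delta> * c" .
    have "card (F \<union> N i \<union> {i} \<union> X3 \<union> X4) \<le> card F + card (N i) + card {i} + card X3 + card X4"
      by (meson card_Un_le add_mono le_refl order_trans)
    also have "\<dots> < n" using X3 X4 big degC[OF ij(1)] by (simp add: N_def algebra_simps)
    finally have "\<not> {..<n} \<subseteq> F \<union> N i \<union> {i} \<union> X3 \<union> X4"
      using card_mono[of "F \<union> N i \<union> {i} \<union> X3 \<union> X4" "{..<n}"] finF fin
      by (auto simp: X3_def X4_def)
    then obtain l where l: "l < n" "l \<notin> F" "l \<noteq> i" "\<not> C i l"
      "\<And>b. b < n \<Longrightarrow> C i b \<Longrightarrow> \<not> B (f b) (f l)" "\<And>b. b < n \<Longrightarrow> C l b \<Longrightarrow> \<not> B (f i) (f b)"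
      by (auto simp: X3_def X4_def N_def)
    define f' where "f' = f \<circ> transpose i l"
    have f': "f' i = f l" "f' l = f i" "\<And>a. a \<noteq> i \<Longrightarrow> a \<noteq> l \<Longrightarrow> f' a = f a"
      by (auto simp: f'_def transpose_def)
    have "bij_betw (transpose i l) {..<n} {..<n}"
      using ij(1) l(1) by (auto intro!: bij_betw_byWitness[of _ "transpose i l"] simp: transpose_def)
    then have "X f'"
      using bij_betw_trans[OF _ bij] f' fF l(2) iF unfolding X_def f'_def by metis
    \<comment> \<open>Since \<open>l\<close> and \<open>i\<close> are not adjacent in
      \<open>C\<close>, the neighbours of either position keep their vertices under the
      exchange.\<close>
    have noi: "\<not> B (f' a) (f' b)" if "a \<in> {i, l}" "b < n" "C a b" for a b
    proof (cases "a = i")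
      case True
      then have "b \<noteq> i" "b \<noteq> l" using that irrC l(4) by auto
      then show ?thesis using True f' l(5)[of b] that symB by auto
    next
      case False
      then have al: "a = l" using that(1) by simp
      then have "b \<noteq> i" "b \<noteq> l" using that irrC l(4) symC by auto
      then show ?thesis using al f' l(6)[of b] that by auto
    qed
    have "K f' \<subseteq> K f - {(i, j)}"
    proof (rule subrelI)
      fix a b assume "(a, b) \<in> K f'"
      then have ab: "a < n" "b < n" "C a b" "B (f' a) (f' b)" by (auto simp: K_def)
      then have "a \<notin> {i, l}" "b \<notin> {i, l}" using noi symB symC by blast+
      then show "(a, b) \<in> K f - {(i, j)}" using ab f'(3) by (auto simp: K_def)
    qed
    moreover have "(i, j) \<in> K f" using ij by (simp add: K_def)
    ultimately have "card (K f') < card (K f)"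
      by (intro psubset_card_mono finK) auto
    then show False using min[OF \<open>X f'\<close>] by simp
  qed
  note free_conflict = this
  have "\<not> B (f i) (f j)" if "i < n" "j < n" "C i j" for i j
  proof (cases "i \<in> F \<and> j \<in> F")
    case True
    then show ?thesis using conf that(3) fF by simp
  next
    case False
    then show ?thesis
      using free_conflict[of i j] free_conflict[of j i] that symC[OF that(3)] symB by blast
  qed
  with bij show thesis by (rule that)
qed

section \<open>Greedy selection of disjoint cliques\<close>

text \<open>Greedy choice: while at least \<open>t\<close> vertices remain, the average degree is
  below \<open>c + 1\<close>, so some vertex has degree at most \<open>c\<close>. Choosing it and
  discarding its neighbours costs at most \<open>c + 1\<close> vertices, and the degree sum does not
  grow.\<close>

lemma independent_subset:
  fixes B :: "nat \<Rightarrow> nat \<Rightarrow> bool"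
  assumes "\<And>u w. B u w \<Longrightarrow> B w u" "finite W"
    and "(\<Sum>w\<in>W. card {u\<in>W. B w u}) < (c + 1) * t" "t + (c + 1) * m \<le> card W"
  shows "\<exists>I\<subseteq>W. card I = m \<and> (\<forall>u\<in>I. \<forall>w\<in>I. u \<noteq> w \<longrightarrow> \<not> B u w)"
  using assms(2-)
proof (induction m arbitrary: W)
  case 0
  then show ?case by (intro exI[of _ "{}"]) auto
next
  case (Suc m)
  have "\<exists>w\<in>W. card {u\<in>W. B w u} \<le> c"
  proof (rule ccontr)
    assume "\<not> ?thesis"
    then have "(\<Sum>w\<in>W. c + 1) \<le> (\<Sum>w\<in>W. card {u\<in>W. B w u})" by (intro sum_mono) auto
    moreover have "(c + 1) * t \<le> (c + 1) * card W" using Suc.prems(3) by (intro mult_left_mono) auto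
    ultimately show False using Suc.prems(2) by (simp add: mult.commute)
  qed
  then obtain w where w: "w \<in> W" "card {u\<in>W. B w u} \<le> c" by blast
  define W' where "W' = W - insert w {u\<in>W. B w u}"
  have fin: "finite W'" using Suc.prems(1) by (simp add: W'_def)
  have sub: "insert w {u\<in>W. B w u} \<subseteq> W" using w(1) by auto
  have "card W = card W' + card (insert w {u\<in>W. B w u})"
    using card_Diff_subset[OF finite_subset[OF sub Suc.prems(1)] sub] card_mono[OF Suc.prems(1) sub]
    by (simp add: W'_def)
  also have "\<dots> \<le> card W' + (c + 1)"
    using w(2) Suc.prems(1) by (simp add: card_insert_if)
  finally have "t + (c + 1) * m \<le> card W'" using Suc.prems(3) by simp
  moreover have "(\<Sum>w\<in>W'. card {u\<in>W'. B w u}) \<le> (\<Sum>w\<in>W. card {u\<in>W. B w u})"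
  proof -
    have "(\<Sum>w\<in>W'. card {u\<in>W'. B w u}) \<le> (\<Sum>w\<in>W'. card {u\<in>W. B w u})"
      using Suc.prems(1) by (intro sum_mono card_mono) (auto simp: W'_def)
    also have "\<dots> \<le> (\<Sum>w\<in>W. card {u\<in>W. B w u})"
      using Suc.prems(1) by (intro sum_mono2) (auto simp: W'_def)
    finally show ?thesis .
  qed
  ultimately obtain I where I: "I \<subseteq> W'" "card I = m" "\<forall>u\<in>I. \<forall>w\<in>I. u \<noteq> w \<longrightarrow> \<not> B u w"
    using Suc.IH[OF fin] Suc.prems(2) by (meson order_le_less_trans)
  have "finite I" using I(1) fin by (rule finite_subset)
  moreover have "w \<notin> I" using I(1) by (auto simp: W'_def)
  ultimately have "card (insert w I) = Suc m" using I(2) by simp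
  moreover have "insert w I \<subseteq> W" using I(1) w(1) by (auto simp: W'_def)
  moreover have "\<not> B w u" "\<not> B u w" if "u \<in> I" for u
    using that I(1) assms(1)[of u w] by (auto simp: W'_def)
  ultimately show ?case using I(3) by (intro exI[of _ "insert w I"]) blast
qed

text \<open>The sets are chosen one after another; \<open>U\<close> stands for what is already
  taken, namely \<open>L\<close> and at most \<open>card L - 1\<close> earlier sets of size
  \<open>m\<close>.\<close>

lemma disjoint_sets_choice:
  assumes "finite L"
    and ex: "\<And>v U. v \<in> L \<Longrightarrow> finite U \<Longrightarrow> L \<subseteq> U \<Longrightarrow> card U \<le> card L + (card L - 1) * m \<Longrightarrow>
      \<exists>N. finite N \<and> card N = m \<and> N \<inter> U = {} \<and> P v N"
  shows "\<exists>N. (\<forall>v\<in>L. finite (N v) \<and> card (N v) = m \<and> N v \<inter> L = {} \<and> P v (N v)) \<and>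
    (\<forall>v\<in>L. \<forall>w\<in>L. v \<noteq> w \<longrightarrow> N v \<inter> N w = {})"
proof -
  have "\<exists>N. (\<forall>v\<in>L'. finite (N v) \<and> card (N v) = m \<and> N v \<inter> L = {} \<and> P v (N v)) \<and>
    (\<forall>v\<in>L'. \<forall>w\<in>L'. v \<noteq> w \<longrightarrow> N v \<inter> N w = {})" if "finite L'" "L' \<subseteq> L" for L'
    using that
  proof (induction L')
    case empty
    then show ?case by auto
  next
    case (insert v L')
    then obtain N where N': "\<forall>v\<in>L'. finite (N v) \<and> card (N v) = m \<and> N v \<inter> L = {} \<and> P v (N v)"
      "\<forall>v\<in>L'. \<forall>w\<in>L'. v \<noteq> w \<longrightarrow> N v \<inter> N w = {}"
      by blast
    note N = N'(1)[rule_format] N'(2)[rule_format]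
    define U where "U = L \<union> (\<Union>w\<in>L'. N w)"
    have "card U \<le> card L + card (\<Union>w\<in>L'. N w)" unfolding U_def by (rule card_Un_le)
    also have "card (\<Union>w\<in>L'. N w) \<le> (\<Sum>w\<in>L'. card (N w))" using insert(1) by (rule card_UN_le)
    also have "\<dots> = card L' * m" using N(1) by simp
    also have "card L' \<le> card L - 1"
      using card_mono[OF assms(1), of "insert v L'"] insert.hyps insert.prems by simp
    finally have "card U \<le> card L + (card L - 1) * m" by simp
    moreover have "finite U" using assms(1) insert(1) N(1) by (auto simp: U_def)
    moreover have "L \<subseteq> U" by (simp add: U_def)
    ultimately obtain M where M: "finite M" "card M = m" "M \<inter> U = {}" "P v M"
      using ex[of v U] insert.prems by auto
    have "M \<inter> L = {}" and MN: "\<And>w. w \<in> L' \<Longrightarrow> M \<inter> N w = {} \<and> N w \<inter> M = {}"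
      using M(3) unfolding U_def by blast+
    then show ?case
      using M(1,2,4) N insert.hyps(2) by (intro exI[of _ "N(v := M)"]) simp
  qed
  from this[OF assms(1)] show ?thesis by simp
qed

section \<open>Embedding powers of cycles\<close>

text \<open>Additive form free of truncated subtraction, for linear arithmetic; the last two
  disjuncts are the pairs whose short arc passes through 0.\<close>

lemma cycle_power_iff:
  "cycle_power n k i j \<longleftrightarrow> i < n \<and> j < n \<and> i \<noteq> j \<and>
    (i \<le> j + k \<and> j \<le> i + k \<or> n + j \<le> i + k \<or> n + i \<le> j + k)"
  unfolding cycle_power_def by (auto simp: min_le_iff_disj)

lemma cycle_power_sym: "cycle_power n k i j \<Longrightarrow> cycle_power n k j i"
  by (auto simp: cycle_power_iff)

text \<open>A crude count: an interval of at most \<open>2 * k + 1\<close> positions and at most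
  \<open>k\<close> positions wrapping around at each end give \<open>4 * k + 1\<close>, which is at
  most \<open>5 * k\<close> for positive \<open>k\<close>.\<close>

lemma cycle_power_degree: "card {j. j < n \<and> cycle_power n k i j} \<le> 5 * k"
proof (cases "i < n \<and> 0 < k")
  case False
  then have "{j. j < n \<and> cycle_power n k i j} = {}"
    by (auto simp: cycle_power_iff)
  then show ?thesis by (metis card.empty le0)
next
  case True
  have "{j. j < n \<and> cycle_power n k i j} \<subseteq> {i - k..i + k} \<union> {..<i + k + 1 - n} \<union> {n + i - k..<n}"
    by (auto simp: cycle_power_iff)
  then have "card {j. j < n \<and> cycle_power n k i j}
      \<le> card ({i - k..i + k} \<union> {..<i + k + 1 - n} \<union> {n + i - k..<n})"
    by (intro card_mono) auto
  also have "\<dots> \<le> card {i - k..i + k} + card {..<i + k + 1 - n} + card {n + i - k..<n}"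
    by (meson card_Un_le add_mono le_refl order_trans)
  also have "\<dots> \<le> (2 * k + 1) + k + k"
    using True by (intro add_mono) auto
  also have "\<dots> \<le> 5 * k" using True by simp
  finally show ?thesis .
qed

text \<open>Each clique fills a block of consecutive positions with \<open>q s k\<close> in the
  middle. All positions within distance \<open>k\<close> of the middle lie in the block, so the
  complement degree of \<open>q s k\<close> never enters the exchange argument and needs no
  bound.\<close>

lemma contains_cycle_power_of_cliques:
  fixes q :: "nat \<Rightarrow> nat \<Rightarrow> nat"
  assumes G: "simple_graph n G"
    and inj: "inj_on (\<lambda>(s, j). q s j) ({..<l} \<times> {..2 * k})"
    and qn: "\<And>s j. s < l \<Longrightarrow> j \<le> 2 * k \<Longrightarrow> q s j < n"
    and clique: "\<And>s i j. s < l \<Longrightarrow> i \<le> 2 * k \<Longrightarrow> j \<le> 2 * k \<Longrightarrow> i \<noteq> j \<Longrightarrow> G (q s i) (q s j)"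
    and low: "\<And>w. w < n \<Longrightarrow> (\<And>s. s < l \<Longrightarrow> w \<noteq> q s k) \<Longrightarrow> card {u. u < n \<and> w \<noteq> u \<and> \<not> G w u} \<le> \<Delta>"
    and big: "(3 * k + 1) * l + 10 * k * \<Delta> + 5 * k + 1 < n"
  shows "contains_subgraph n G n (cycle_power n k)"
proof -
  \<comment> \<open>A block of \<open>2 * k + 1\<close> positions followed by a gap of
    \<open>k\<close>, so that positions in different blocks are never adjacent in the cycle
    power.\<close>
  define M where "M = 3 * k + 1"
  have M: "M > 0" "2 * k < M" by (auto simp: M_def)
  define F where "F = {p. p < M * l \<and> p mod M \<le> 2 * k}"
  define g where "g p = q (p div M) (p mod M)" for p
  define B where "B u w \<longleftrightarrow> u \<noteq> w \<and> \<not> G u w" for u w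
  have divl: "p div M < l" if "p \<in> F" for p
    using that M by (auto simp: F_def less_mult_imp_div_less mult.commute)
  have modk: "p mod M \<le> 2 * k" if "p \<in> F" for p
    using that by (simp add: F_def)
  have mem: "M * s + j \<in> F" if "s < l" "j \<le> 2 * k" for s j
  proof -
    have "M * Suc s \<le> M * l" using that(1) by (intro mult_le_mono) auto
    then show ?thesis using that M by (simp add: F_def)
  qed
  have dm: "p = M * (p div M) + p mod M" for p by simp
  have recon: "p = M * s + r" if "p div M = s" "p mod M = r" for p s r
    by (simp only: that[symmetric] mult_div_mod_eq)
  have FMl: "p < M * l" if "p \<in> F" for p using that by (simp add: F_def)
  have bigM: "M * l + 10 * k * \<Delta> + 5 * k + 1 < n" using big by (simp add: M_def)
  have same: "p div M = p' div M" if "p \<in> F" "p' \<in> F" "cycle_power n k p p'" "p \<le> p'" for p p'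
  proof (rule ccontr)
    assume "p div M \<noteq> p' div M"
    then have "Suc (p div M) \<le> p' div M" using div_le_mono[OF that(4), of M] by simp
    then have "M * Suc (p div M) \<le> M * (p' div M)" by (rule mult_le_mono2)
    then have "p + k < p'" using dm[of p] dm[of p'] modk[OF that(1)] by (simp add: M_def)
    then show False using that(3,4) FMl[OF that(2)] bigM by (auto simp: cycle_power_iff)
  qed
  have injg: "inj_on g F"
  proof (rule inj_onI)
    fix p p' assume p: "p \<in> F" "p' \<in> F" "g p = g p'"
    then have "(p div M, p mod M) = (p' div M, p' mod M)"
      using divl modk by (intro inj_onD[OF inj]) (auto simp: g_def)
    then show "p = p'" using recon[of p "p' div M" "p' mod M"] by simp
  qed
  have lowB: "card {u. u < n \<and> B w u} \<le> \<Delta>" if "w < n" "\<And>s. s < l \<Longrightarrow> w \<noteq> q s k" for w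
    using low[OF that] by (simp add: B_def)
  have "card F \<le> card {..<M * l}" by (intro card_mono) (auto simp: F_def)
  then have cardF: "card F \<le> M * l" by simp
  have "\<exists>f. bij_betw f {..<n} {..<n} \<and> (\<forall>i<n. \<forall>j<n. cycle_power n k i j \<longrightarrow> \<not> B (f i) (f j))"
  proof (rule conflict_free_bijection[where C = "cycle_power n k" and B = B and F = F and g = g
        and n = n and c = "5 * k" and \<Delta> = \<Delta>])
    show "cycle_power n k j i" if "cycle_power n k i j" for i j using that by (rule cycle_power_sym)
    show "\<not> cycle_power n k i i" for i by (simp add: cycle_power_iff)
    show "B w u" if "B u w" for u w using that simple_graphD(4)[OF G] by (auto simp: B_def)
    show "F \<subseteq> {..<n}" using FMl bigM by fastforce
    show "inj_on g F" by (rule injg)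
    show "g ` F \<subseteq> {..<n}" using qn divl modk by (auto simp: g_def)
    show "card {j. j < n \<and> cycle_power n k i j} \<le> 5 * k" for i by (rule cycle_power_degree)
    show "\<not> B (g i) (g j)" if "i \<in> F" "j \<in> F" "cycle_power n k i j" for i j
    proof -
      have eq: "i div M = j div M"
        using same[OF that] same[OF that(2,1) cycle_power_sym[OF that(3)]] by linarith
      have "i \<noteq> j" using that(3) by (simp add: cycle_power_iff)
      then have "i mod M \<noteq> j mod M" using recon[OF eq, of "j mod M"] by auto
      then have "G (q (i div M) (i mod M)) (q (i div M) (j mod M))"
        by (intro clique divl modk that)
      then show ?thesis using eq by (simp add: B_def g_def)
    qed
    show "card {u. u < n \<and> B w u} \<le> \<Delta>" if "w < n" "w \<notin> g ` F" for w
    proof (rule lowB[OF that(1)])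
      fix s assume "s < l"
      then have "M * s + k \<in> F" by (intro mem) auto
      moreover have "g (M * s + k) = q s k" using M by (simp add: g_def)
      ultimately show "w \<noteq> q s k" using that(2) by force
    qed
    \<comment> \<open>If \<open>g i\<close> were a middle vertex \<open>q s k\<close>, then
      \<open>i = M * s + k\<close> and its neighbour \<open>j\<close> would lie between
      \<open>M * s\<close> and \<open>M * s + 2 * k\<close>, hence in \<open>F\<close>.\<close>
    show "card {u. u < n \<and> B (g i) u} \<le> \<Delta>" if "i \<in> F" "j < n" "j \<notin> F" "cycle_power n k i j" for i j
    proof (rule lowB)
      show "g i < n" using qn divl modk that(1) by (auto simp: g_def)
      fix s assume s: "s < l"
      show "g i \<noteq> q s k"
      proof
        assume "g i = q s k"
        then have "(i div M, i mod M) = (s, k)"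
          using s divl modk that(1) by (intro inj_onD[OF inj]) (auto simp: g_def)
        then have i: "i = M * s + k" by (intro recon) simp_all
        have "i + k < n" using FMl[OF that(1)] bigM by simp
        then have j: "i \<le> j + k" "j \<le> i + k" using that(2,4) i by (auto simp: cycle_power_iff)
        have "M * s + (j - M * s) \<in> F" using i j by (intro mem s) simp
        moreover have "M * s + (j - M * s) = j" using i j by simp
        ultimately show False using that(3) by simp
      qed
    qed
    show "card F + 2 * (5 * k) * \<Delta> + 5 * k + 1 < n" using cardF bigM by simp
  qed blast
  then obtain f where f: "bij_betw f {..<n} {..<n}"
    "\<And>i j. i < n \<Longrightarrow> j < n \<Longrightarrow> cycle_power n k i j \<Longrightarrow> \<not> B (f i) (f j)"
    by blast
  show ?thesis
    unfolding contains_subgraph_def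
  proof (intro exI[of _ f] conjI allI impI)
    show "inj_on f {0..<n}" "f ` {0..<n} \<subseteq> {0..<n}"
      using f(1) by (auto simp: bij_betw_def lessThan_atLeast0)
    fix i j assume ij: "i < n" "j < n" "cycle_power n k i j"
    then have "f i \<noteq> f j" using f(1) by (auto simp: bij_betw_def inj_on_def cycle_power_iff)
    then show "G (f i) (f j)" using f(2)[OF ij] by (simp add: B_def)
  qed
qed

text \<open>Each vertex of large degree in the complement gets
  \<open>2 k\<close> consecutive neighbours of its own; these form a clique, found greedily because
  the complement is sparse around them.\<close>

lemma contains_cycle_power_of_high_vertices:
  assumes G: "simple_graph n G" and L: "L \<subseteq> {..<n}"
    and low: "\<And>w. w < n \<Longrightarrow> w \<notin> L \<Longrightarrow> card {u. u < n \<and> w \<noteq> u \<and> \<not> G w u} \<le> \<Delta>"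
    and ex: "\<And>v U. v \<in> L \<Longrightarrow> finite U \<Longrightarrow> L \<subseteq> U \<Longrightarrow> card U \<le> card L + (card L - 1) * (2 * k) \<Longrightarrow>
      \<exists>N. finite N \<and> card N = 2 * k \<and> N \<inter> U = {} \<and>
        (\<forall>u\<in>N. G v u) \<and> (\<forall>u\<in>N. \<forall>w\<in>N. u \<noteq> w \<longrightarrow> G u w)"
    and big: "(3 * k + 1) * card L + 10 * k * \<Delta> + 5 * k + 1 < n"
  shows "contains_subgraph n G n (cycle_power n k)"
proof -
  define l where "l = card L"
  have finL: "finite L" using L finite_subset by blast
  define P where "P v N \<longleftrightarrow> (\<forall>u\<in>N. G v u) \<and> (\<forall>u\<in>N. \<forall>w\<in>N. u \<noteq> w \<longrightarrow> G u w)" for v N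
  have "\<exists>N. (\<forall>v\<in>L. finite (N v) \<and> card (N v) = 2 * k \<and> N v \<inter> L = {} \<and> P v (N v)) \<and>
      (\<forall>v\<in>L. \<forall>w\<in>L. v \<noteq> w \<longrightarrow> N v \<inter> N w = {})"
  proof (rule disjoint_sets_choice[OF finL])
    fix v and U :: "nat set" assume "v \<in> L" "finite U" "L \<subseteq> U" "card U \<le> card L + (card L - 1) * (2 * k)"
    from ex[OF this] show "\<exists>N. finite N \<and> card N = 2 * k \<and> N \<inter> U = {} \<and> P v N"
      unfolding P_def .
  qed
  then obtain N where N': "\<forall>v\<in>L. finite (N v) \<and> card (N v) = 2 * k \<and> N v \<inter> L = {} \<and> P v (N v)"
      and disj: "\<forall>v\<in>L. \<forall>w\<in>L. v \<noteq> w \<longrightarrow> N v \<inter> N w = {}"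
    by (elim exE conjE)
  have N: "finite (N v)" "card (N v) = 2 * k" "N v \<inter> L = {}" "\<And>u. u \<in> N v \<Longrightarrow> G v u"
    "\<And>u w. u \<in> N v \<Longrightarrow> w \<in> N v \<Longrightarrow> u \<noteq> w \<Longrightarrow> G u w" if "v \<in> L" for v
    using N'[rule_format, OF that] by (auto simp: P_def)
  obtain h where h: "bij_betw h {..<l} L"
    using finL finite_same_card_bij[of "{..<l}" L] by (auto simp: l_def)
  have hL: "h s \<in> L" if "s < l" for s using h that by (auto simp: bij_betw_def)
  have "\<exists>e. bij_betw e ({..2 * k} - {k}) (N v)" if "v \<in> L" for v
    using N(1,2)[OF that] by (intro finite_same_card_bij) auto
  then obtain e where e: "\<And>v. v \<in> L \<Longrightarrow> bij_betw (e v) ({..2 * k} - {k}) (N v)" by metis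
  define q where "q s j = (if j = k then h s else e (h s) j)" for s j
  have eN: "e v j \<in> N v" if "v \<in> L" "j \<le> 2 * k" "j \<noteq> k" for v j
    using e[OF that(1)] that(2,3) by (auto simp: bij_betw_def)
  have einj: "i = j" if "v \<in> L" "i \<le> 2 * k" "i \<noteq> k" "j \<le> 2 * k" "j \<noteq> k" "e v i = e v j" for v i j
    using e[OF that(1)] that(2-) by (auto simp: bij_betw_def inj_on_def)
  have Gn: "u < n" if "G v u" for u v using simple_graphD(2)[OF G that] .
  show ?thesis
  proof (rule contains_cycle_power_of_cliques[OF G])
    show "inj_on (\<lambda>(s, j). q s j) ({..<l} \<times> {..2 * k})"
    proof (rule inj_onI, clarsimp)
      fix s i t j assume *: "s < l" "i \<le> 2 * k" "t < l" "j \<le> 2 * k" "q s i = q t j"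
      note hs = hL[OF *(1)] and ht = hL[OF *(3)]
      have hst: "s = t" if "h s = h t"
        using h that *(1,3) by (auto simp: bij_betw_def inj_on_def)
      have NL: "x \<notin> L" if "v \<in> L" "x \<in> N v" for v x using N(3) that by blast
      have ik: "i = k \<longleftrightarrow> j = k"
        using *(5) NL[OF hs eN[OF hs *(2)]] NL[OF ht eN[OF ht *(4)]] hs ht
        by (auto simp: q_def split: if_splits)
      show "s = t \<and> i = j"
      proof (cases "i = k")
        case True
        then show ?thesis using *(5) ik hst by (simp add: q_def)
      next
        case False
        then have eq: "e (h s) i = e (h t) j" and jk: "j \<noteq> k" using *(5) ik by (auto simp: q_def)
        have "h s = h t"
          using eN[OF hs *(2) False] eN[OF ht *(4) jk] eq disj hs ht by fastforce
        then show ?thesis using eq einj[OF hs *(2) False *(4) jk] hst by simp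
      qed
    qed
    show "G (q s i) (q s j)" if "s < l" "i \<le> 2 * k" "j \<le> 2 * k" "i \<noteq> j" for s i j
    proof -
      note v = hL[OF that(1)] and ne = that(4)
      consider "i = k" "j \<noteq> k" | "i \<noteq> k" "j = k" | "i \<noteq> k" "j \<noteq> k" using ne by blast
      then show ?thesis
      proof cases
        case 1
        then show ?thesis using N(4)[OF v eN[OF v that(3)]] by (simp add: q_def)
      next
        case 2
        then show ?thesis using simple_graphD(4)[OF G N(4)[OF v eN[OF v that(2)]]] by (simp add: q_def)
      next
        case 3
        then show ?thesis
          using N(5)[OF v eN[OF v that(2)] eN[OF v that(3)]] einj[OF v that(2) _ that(3)] that(4)
          by (auto simp: q_def)
      qed
    qed
    show "q s j < n" if "s < l" "j \<le> 2 * k" for s j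
    proof (cases "j = k")
      case True
      then show ?thesis using L hL[OF that(1)] by (auto simp: q_def)
    next
      case False
      then show ?thesis
        using Gn[OF N(4)[OF hL[OF that(1)] eN[OF hL[OF that(1)] that(2) False]]] by (simp add: q_def)
    qed
    show "card {u. u < n \<and> w \<noteq> u \<and> \<not> G w u} \<le> \<Delta>" if "w < n" "\<And>s. s < l \<Longrightarrow> w \<noteq> q s k" for w
    proof (rule low[OF that(1)])
      show "w \<notin> L"
      proof
        assume "w \<in> L"
        then obtain s where "s < l" "w = h s" using h by (auto simp: bij_betw_def)
        then show False using that(2)[of s] by (simp add: q_def)
      qed
    qed
    show "(3 * k + 1) * l + 10 * k * \<Delta> + 5 * k + 1 < n" using big by (simp add: l_def)
  qed
qed

section \<open>The complement of a graph of large spectral radius\<close>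

text \<open>The Perron vector is scaled to have maximum \<open>1\<close>; then its entries fall short of
  \<open>1\<close> by at most \<open>1\<close> in total, so that weighted edge counts of the complement control
  the unweighted ones.\<close>

lemma complement_sparse:
  assumes G: "simple_graph n G" and n: "n \<ge> 14" and rho: "real n - 2 \<le> spec_rad n G"
  shows "(\<Sum>w<n. card {u. u < n \<and> w \<noteq> u \<and> \<not> G w u}) \<le> 3 * n" (is ?total)
    and "v < n \<Longrightarrow> (\<Sum>w\<in>{..<n} - {v}. card {u. u < n \<and> u \<noteq> v \<and> w \<noteq> u \<and> \<not> G w u})
      \<le> 7 * card {u. u < n \<and> G v u}" (is "_ \<Longrightarrow> ?off")
    and "v < n \<Longrightarrow> (card {u. u < n \<and> G v u})\<^sup>2 + 2 < n \<Longrightarrow> a < n \<Longrightarrow> b < n \<Longrightarrow>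
      a \<noteq> v \<Longrightarrow> b \<noteq> v \<Longrightarrow> a \<noteq> b \<Longrightarrow> G a b"
proof -
  obtain x z where x0: "\<And>i. 0 \<le> x i" and x1: "\<And>i. i < n \<Longrightarrow> x i \<le> 1" and z: "z < n" "x z = 1"
    and eig: "\<And>i. i < n \<Longrightarrow> (\<Sum>j<n. of_bool (G i j) * x j) = spec_rad n G * x i"
    using spec_rad_eigenvector[of n G] G n by (metis not_numeral_le_zero gr0I)
  define l where "l = spec_rad n G"
  define S where "S = (\<Sum>i<n. x i)"
  define B where "B u w \<longleftrightarrow> u \<noteq> w \<and> \<not> G u w" for u w
  define d where "d v = card {u. u < n \<and> G v u}" for v
  define b where "b w = card {u. u < n \<and> B w u}" for w
  define c where "c v w = card {u. u < n \<and> u \<noteq> v \<and> B w u}" for v w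
  have l: "real n - 1 \<le> l + 1" using rho by (simp add: l_def)
  have symB: "B u w \<longleftrightarrow> B w u" for u w using simple_graphD(4)[OF G] by (auto simp: B_def)
  have split: "of_bool (G u w) + of_bool (B u w) + of_bool (w = u) = (1::real)" for u w
    using simple_graphD(3)[OF G] by (auto simp: B_def of_bool_def)
  \<comment> \<open>The adjacency matrices of \<open>G\<close> and its complement and the identity
    matrix sum to the all-ones matrix; this is applied to the eigenvector.\<close>
  have eq: "(l + 1) * x u = S - (\<Sum>w<n. of_bool (B u w) * x w)" if "u < n" for u
  proof -
    have "S = (\<Sum>w<n. (of_bool (G u w) + of_bool (B u w) + of_bool (w = u)) * x w)"
      by (simp only: split S_def mult_1)
    also have "\<dots> = (\<Sum>w<n. of_bool (G u w) * x w) + (\<Sum>w<n. of_bool (B u w) * x w)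
        + (\<Sum>w<n. of_bool (w = u) * x w)"
      by (simp only: distrib_right sum.distrib)
    also have "(\<Sum>w<n. of_bool (w = u) * x w) = x u"
      using that by (simp add: of_bool_def if_distrib[of "\<lambda>a. a * _"] cong: if_cong)
    finally show ?thesis using eig[OF that] by (simp add: l_def algebra_simps)
  qed
  have S1: "real n - 1 \<le> S"
  proof -
    have "0 \<le> (\<Sum>w<n. of_bool (B z w) * x w)" using x0 by (intro sum_nonneg) auto
    then show ?thesis using eq[OF z(1)] z(2) l by simp
  qed
  have Sn: "S \<le> real n" using sum_mono[of "{..<n}" x "\<lambda>_. 1"] x1 by (simp add: S_def)
  \<comment> \<open>The shortfalls \<open>1 - x i\<close> are nonnegative and sum to at most 1, so
    at most one entry is below 1/2.\<close>
  have pair: "1 \<le> x u + x w" if "u < n" "w < n" "u \<noteq> w" for u w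
  proof -
    have "(\<Sum>i\<in>{u, w}. 1 - x i) \<le> (\<Sum>i<n. 1 - x i)"
      using that x1 by (intro sum_mono2) auto
    also have "\<dots> \<le> 1" using S1 by (simp add: sum_subtractf S_def)
    finally show ?thesis using that by simp
  qed
  have half: "1 / 2 \<le> x w" if "u < n" "w < n" "u \<noteq> w" "x u < 1 / 2" for u w
    using pair[OF that(1-3)] that(4) by simp
  have lx: "(real n - 2) * x v \<le> d v" if "v < n" for v
  proof -
    have "(real n - 2) * x v \<le> l * x v" using l x0 by (intro mult_right_mono) auto
    also have "\<dots> = (\<Sum>j<n. of_bool (G v j) * x j)" using eig[OF that] by (simp add: l_def)
    also have "\<dots> \<le> (\<Sum>j<n. of_bool (G v j))" using x1 x0 by (intro sum_mono) (auto simp: of_bool_def)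
    also have "\<dots> = d v" by (simp add: d_def Collect_conj_eq lessThan_def)
    finally show ?thesis .
  qed
  have total: "(\<Sum>w<n. x w * b w) \<le> S"
  proof -
    have "(\<Sum>u<n. \<Sum>w<n. of_bool (B u w) * x w) = (\<Sum>w<n. \<Sum>u<n. x w * of_bool (B w u))"
      by (subst sum.swap) (simp only: symB mult.commute)
    also have "\<dots> = (\<Sum>w<n. x w * b w)"
      unfolding sum_distrib_left[symmetric] by (simp add: b_def Collect_conj_eq lessThan_def)
    finally have swap: "(\<Sum>u<n. \<Sum>w<n. of_bool (B u w) * x w) = (\<Sum>w<n. x w * b w)" .
    have "(\<Sum>u<n. (l + 1) * x u) = (\<Sum>u<n. S - (\<Sum>w<n. of_bool (B u w) * x w))"
      by (intro sum.cong refl eq) simp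
    then have "(l + 1) * S = real n * S - (\<Sum>w<n. x w * b w)"
      unfolding sum_subtractf swap sum_distrib_left[symmetric] by (simp add: S_def)
    moreover have "(real n - 1) * S \<le> (l + 1) * S" using l S1 n by (intro mult_right_mono) auto
    ultimately show ?thesis by (simp add: algebra_simps)
  qed
  \<comment> \<open>The identity \<open>eq\<close> is summed over all vertices except
    \<open>v\<close>. The complement edges at \<open>v\<close> contribute
    \<open>x v * (n - 1 - d v)\<close>, which cancels the loss from omitting \<open>v\<close> up to
    \<open>d v * x v\<close>.\<close>
  have off: "(\<Sum>w\<in>{..<n} - {v}. x w * c v w) \<le> d v * x v" if v: "v < n" for v
  proof -
    define U where "U = {..<n} - {v}"
    have cU: "(\<Sum>u\<in>U. of_bool (B w u)) = real (c v w)" for w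
    proof -
      have "(\<Sum>u\<in>U. of_bool (B w u)) = real (card (U \<inter> {u. B w u}))" by (simp add: U_def)
      also have "U \<inter> {u. B w u} = {u. u < n \<and> u \<noteq> v \<and> B w u}" by (auto simp: U_def)
      finally show ?thesis by (simp add: c_def)
    qed
    have cv: "real (c v v) = real n - 1 - d v"
    proof -
      have "{u. u < n \<and> u \<noteq> v \<and> B v u} = U - {u. u < n \<and> G v u}" by (auto simp: U_def B_def)
      moreover have sub: "{u. u < n \<and> G v u} \<subseteq> U" using simple_graphD(3)[OF G] by (auto simp: U_def)
      ultimately have "c v v = card U - d v" by (simp add: c_def d_def card_Diff_subset)
      moreover have "d v \<le> card U" unfolding d_def using sub by (intro card_mono) (auto simp: U_def)
      moreover have "card U = n - 1" using v by (simp add: U_def)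
      ultimately show ?thesis using n by simp
    qed
    have SU: "(\<Sum>u\<in>U. x u) = S - x v" using v by (simp add: U_def S_def sum_diff1)
    have "(\<Sum>u\<in>U. \<Sum>w<n. of_bool (B u w) * x w) = (\<Sum>w<n. \<Sum>u\<in>U. x w * of_bool (B w u))"
      by (subst sum.swap) (simp only: symB mult.commute)
    also have "\<dots> = (\<Sum>w<n. x w * c v w)" by (simp only: sum_distrib_left[symmetric] cU)
    also have "\<dots> = x v * c v v + (\<Sum>w\<in>U. x w * c v w)"
      using v by (simp add: U_def sum.remove)
    finally have "(\<Sum>u\<in>U. \<Sum>w<n. of_bool (B u w) * x w) = x v * (real n - 1 - d v) + (\<Sum>w\<in>U. x w * c v w)"
      by (simp only: cv)
    moreover have "(\<Sum>u\<in>U. (l + 1) * x u) = (\<Sum>u\<in>U. S - (\<Sum>w<n. of_bool (B u w) * x w))"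
      by (intro sum.cong refl eq) (simp add: U_def)
    moreover have "real (card U) = real n - 1" using v n by (simp add: U_def)
    ultimately have "(l + 1) * (S - x v) = (real n - 1) * S - (x v * (real n - 1 - d v) + (\<Sum>w\<in>U. x w * c v w))"
      by (simp add: sum_subtractf sum_distrib_left[symmetric] SU)
    moreover have "(real n - 1) * (S - x v) \<le> (l + 1) * (S - x v)"
      using l S1 n x1[OF v] by (intro mult_right_mono) auto
    ultimately show ?thesis by (simp add: U_def algebra_simps)
  qed
  have double: "(\<Sum>w\<in>A. real (g w)) \<le> 2 * (\<Sum>w\<in>A. x w * g w)"
    if "\<And>w. w \<in> A \<Longrightarrow> 1 / 2 \<le> x w" for A and g :: "nat \<Rightarrow> nat"
    unfolding sum_distrib_left using mult_right_mono[OF that, of _ "real (g _)"]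
    by (intro sum_mono) (simp add: field_simps)
  have bn: "b w \<le> n" for w
    unfolding b_def using card_mono[of "{..<n}" "{u. u < n \<and> B w u}"] by auto
  have total3: "(\<Sum>w<n. b w) \<le> 3 * n"
  proof -
    \<comment> \<open>\<open>v\<close> is the only vertex whose entry may be below 1/2. It adds at
      most \<open>n\<close> to the sum, and the other vertices at most \<open>2 * n\<close>.\<close>
    obtain v where v: "v < n" "\<And>w. w < n \<Longrightarrow> w \<noteq> v \<Longrightarrow> 1 / 2 \<le> x w"
    proof (cases "\<exists>v<n. x v < 1 / 2")
      case True
      then show ?thesis using that half by metis
    next
      case False
      then show ?thesis using that[of 0] n by (meson not_le less_le_trans zero_less_numeral)
    qed
    have "(\<Sum>w\<in>{..<n} - {v}. real (b w)) \<le> 2 * (\<Sum>w\<in>{..<n} - {v}. x w * b w)"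
      using v(2) by (intro double) auto
    also have "\<dots> \<le> 2 * (\<Sum>w<n. x w * b w)"
      using x0 by (intro mult_left_mono sum_mono2) auto
    also have "\<dots> \<le> 2 * real n" using total Sn by simp
    finally have "real (\<Sum>w\<in>{..<n} - {v}. b w) \<le> real (2 * n)" by simp
    then have "(\<Sum>w\<in>{..<n} - {v}. b w) \<le> 2 * n" by (simp only: of_nat_le_iff)
    then show ?thesis using bn[of v] v(1) by (simp add: sum.remove)
  qed
  then show ?total by (simp add: b_def B_def)
  have cb: "(\<Sum>w\<in>{..<n} - {v}. c v w) \<le> (\<Sum>w<n. b w)" for v
  proof -
    have "(\<Sum>w\<in>{..<n} - {v}. c v w) \<le> (\<Sum>w\<in>{..<n} - {v}. b w)"
      unfolding c_def b_def by (intro sum_mono card_mono) auto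
    also have "\<dots> \<le> (\<Sum>w<n. b w)" by (intro sum_mono2) auto
    finally show ?thesis .
  qed
  \<comment> \<open>If \<open>x v\<close> is below 1/2, all other entries are at least 1/2 and the
    bound is even \<open>d v\<close>. Otherwise \<open>d v\<close> is at least
    \<open>(n - 2) / 2\<close>, and \<open>3 * n \<le> 7 * d v\<close> follows from
    \<open>n \<ge> 14\<close>.\<close>
  have off7: "(\<Sum>w\<in>{..<n} - {v}. c v w) \<le> 7 * d v" if v: "v < n" for v
  proof (cases "x v < 1 / 2")
    case True
    have "(\<Sum>w\<in>{..<n} - {v}. real (c v w)) \<le> 2 * (\<Sum>w\<in>{..<n} - {v}. x w * c v w)"
      using half[OF v] True by (intro double) auto
    also have "\<dots> \<le> 2 * (d v * x v)" using off[OF v] by simp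
    also have "\<dots> \<le> d v * 1" using mult_left_mono[of "x v" "1 / 2" "real (d v)"] True by simp
    finally have "real (\<Sum>w\<in>{..<n} - {v}. c v w) \<le> real (d v)" by simp
    then have "(\<Sum>w\<in>{..<n} - {v}. c v w) \<le> d v" by (simp only: of_nat_le_iff)
    then show ?thesis by simp
  next
    case False
    then have "(real n - 2) * (1 / 2) \<le> (real n - 2) * x v" using n by (intro mult_left_mono) auto
    then have "real n - 2 \<le> 2 * real (d v)" using lx[OF v] by simp
    then show ?thesis using cb[of v] total3 n by linarith
  qed
  then show "v < n \<Longrightarrow> ?off" by (simp add: c_def d_def B_def)
  show "G a b" if "v < n" "(card {u. u < n \<and> G v u})\<^sup>2 + 2 < n" "a < n" "b < n" "a \<noteq> v" "b \<noteq> v" "a \<noteq> b"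
    for v a b
  proof (rule ccontr)
    assume "\<not> G a b"
    then have "b \<in> {u. u < n \<and> u \<noteq> v \<and> B a u}" "a \<in> {u. u < n \<and> u \<noteq> v \<and> B b u}"
      using that symB[of a b] by (auto simp: B_def)
    then have "c v a \<noteq> 0" "c v b \<noteq> 0" unfolding c_def by (auto simp: card_eq_0_iff)
    \<comment> \<open>A nonedge \<open>a b\<close> avoiding \<open>v\<close> counts at both ends,
      and \<open>x a + x b\<close> is at least 1; hence \<open>1 \<le> d v * x v\<close>, and
      \<open>lx\<close> turns this into a lower bound on the square of \<open>d v\<close>.\<close>
    then have "x a * 1 \<le> x a * c v a" "x b * 1 \<le> x b * c v b"
      using x0 by (intro mult_left_mono; simp)+
    then have "1 \<le> x a * c v a + x b * c v b" using pair[OF that(3,4,7)] by simp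
    also have "\<dots> = (\<Sum>w\<in>{a, b}. x w * c v w)" using that(7) by simp
    also have "\<dots> \<le> (\<Sum>w\<in>{..<n} - {v}. x w * c v w)"
      using that x0 by (intro sum_mono2) auto
    also have "\<dots> \<le> d v * x v" by (rule off[OF that(1)])
    finally have "(real n - 2) * 1 \<le> (real n - 2) * (d v * x v)"
      using n by (intro mult_left_mono) auto
    also have "\<dots> = d v * ((real n - 2) * x v)" by simp
    also have "\<dots> \<le> real (d v) * real (d v)" using lx[OF that(1)] by (intro mult_left_mono) auto
    finally have "real n - 2 \<le> (real (d v))\<^sup>2" by (simp add: power2_eq_square)
    then have "real n \<le> real ((d v)\<^sup>2 + 2)" by simp
    then have "n \<le> (d v)\<^sup>2 + 2" by (simp only: of_nat_le_iff)
    then show False using that(2) by (simp add: d_def)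
  qed
qed

lemma contains_cycle_power_of_spec_rad:
  assumes G: "simple_graph n G" and k: "k \<ge> 1" and n: "n \<ge> 1000000 * k ^ 4"
    and rho: "real n - 2 \<le> spec_rad n G"
    and deg: "\<And>v. v < n \<Longrightarrow> 2 * k \<le> card {u. u < n \<and> G v u}"
  shows "contains_subgraph n G n (cycle_power n k)"
proof -
  define kk where "kk = k * k"
  have kk: "k \<le> kk" "1 \<le> kk" "kk \<le> kk * kk" "k ^ 4 = kk * kk"
    using k by (auto simp: kk_def power4_eq_xxxx)
  have n14: "n \<ge> 14" using n kk by linarith
  note sparse = complement_sparse[OF G n14 rho]
  show ?thesis
  proof (cases "\<exists>v<n. card {u. u < n \<and> G v u} \<le> 500 * kk")
    case True
    then obtain v where v: "v < n" "card {u. u < n \<and> G v u} \<le> 500 * kk" by blast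
    have "(card {u. u < n \<and> G v u})\<^sup>2 \<le> (500 * kk)\<^sup>2" using v(2) by (rule power_mono) simp
    also have "\<dots> = 250000 * (kk * kk)" by (simp add: power2_eq_square)
    finally have small: "(card {u. u < n \<and> G v u})\<^sup>2 + 2 < n" using n kk by linarith
    note adj = sparse(3)[OF v(1) small]
    \<comment> \<open>The graph without \<open>v\<close> is complete, so any \<open>2 * k\<close>
      neighbours of \<open>v\<close> form a clique and every other vertex has at most the one
      non-neighbour \<open>v\<close>.\<close>
    show ?thesis
    proof (rule contains_cycle_power_of_high_vertices[OF G, of "{v}" 1])
      show "card {u. u < n \<and> w \<noteq> u \<and> \<not> G w u} \<le> 1" if "w < n" "w \<notin> {v}" for w
      proof -
        have "{u. u < n \<and> w \<noteq> u \<and> \<not> G w u} \<subseteq> {v}" using adj[of w] that by auto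
        then show ?thesis using card_mono[of "{v}"] by fastforce
      qed
      fix v' and U :: "nat set"
      assume *: "v' \<in> {v}" "finite U" "{v} \<subseteq> U" "card U \<le> card {v} + (card {v} - 1) * (2 * k)"
      then have U: "U = {v}" using card_seteq[of U "{v}"] by simp
      obtain N where N: "N \<subseteq> {u. u < n \<and> G v u}" "card N = 2 * k"
        using deg[OF v(1)] obtain_subset_with_card_n by metis
      have "finite N" using N(1) by (rule finite_subset) simp
      moreover have "v \<notin> N" using N(1) simple_graphD(3)[OF G] by blast
      moreover have "G u w" if "u \<in> N" "w \<in> N" "u \<noteq> w" for u w
        using adj[of u w] that N(1) \<open>v \<notin> N\<close> by blast
      ultimately show "\<exists>N. finite N \<and> card N = 2 * k \<and> N \<inter> U = {} \<and> (\<forall>u\<in>N. G v' u) \<and>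
          (\<forall>u\<in>N. \<forall>w\<in>N. u \<noteq> w \<longrightarrow> G u w)"
        using *(1) N U by (intro exI[of _ N]) auto
    next
      have "18 * k + 2 < n" using n kk by linarith
      then show "(3 * k + 1) * card {v} + 10 * k * 1 + 5 * k + 1 < n" by simp
    qed (use v in auto)
  next
    case False
    \<comment> \<open>With this bound \<open>10 * k * \<Delta>\<close> uses at most half of
      \<open>n\<close>, and the total \<open>3 * n\<close> of the complement degrees still leaves
      fewer than \<open>60 * k\<close> vertices above it.\<close>
    define \<Delta> where "\<Delta> = n div (20 * k)"
    define L where "L = {w. w < n \<and> \<Delta> < card {u. u < n \<and> w \<noteq> u \<and> \<not> G w u}}"
    have \<Delta>: "20 * k * \<Delta> \<le> n" "n < 20 * k * (\<Delta> + 1)"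
      using k dividend_less_times_div[of "20 * k" n] times_div_less_eq_dividend[of "20 * k" n]
      by (simp_all add: \<Delta>_def distrib_left)
    have Ln: "L \<subseteq> {..<n}" by (auto simp: L_def)
    have cardL: "card L < 60 * k"
    proof -
      have "card L * (\<Delta> + 1) = (\<Sum>w\<in>L. \<Delta> + 1)" by simp
      also have "\<dots> \<le> (\<Sum>w\<in>L. card {u. u < n \<and> w \<noteq> u \<and> \<not> G w u})"
        by (intro sum_mono) (auto simp: L_def)
      also have "\<dots> \<le> (\<Sum>w<n. card {u. u < n \<and> w \<noteq> u \<and> \<not> G w u})"
        using Ln by (intro sum_mono2) auto
      also have "\<dots> \<le> 3 * n" by (rule sparse(1))
      also have "\<dots> < 60 * k * (\<Delta> + 1)" using \<Delta>(2) by simp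
      finally show ?thesis by (simp only: mult_less_cancel2)
    qed
    show ?thesis
    proof (rule contains_cycle_power_of_high_vertices[OF G Ln, of \<Delta>])
      show "card {u. u < n \<and> w \<noteq> u \<and> \<not> G w u} \<le> \<Delta>" if "w < n" "w \<notin> L" for w
        using that by (auto simp: L_def not_less)
      have "(3 * k + 1) * card L \<le> (4 * k) * (60 * k)" using cardL k by (intro mult_le_mono) auto
      then have "(3 * k + 1) * card L \<le> 240 * kk" by (simp add: kk_def)
      then show "(3 * k + 1) * card L + 10 * k * \<Delta> + 5 * k + 1 < n" 
        using \<Delta>(1) n kk by linarith
      fix v and U :: "nat set"
      assume v: "v \<in> L" and U: "finite U" "card U \<le> card L + (card L - 1) * (2 * k)"
      define d where "d = card {u. u < n \<and> G v u}"
      have d: "500 * kk < d" using False v by (auto simp: d_def L_def)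
      define W where "W = {u. u < n \<and> G v u} - U"
      define B where "B u w \<longleftrightarrow> u \<noteq> w \<and> \<not> G u w" for u w
      have "card L + (card L - 1) * (2 * k) \<le> 60 * k * 1 + (60 * k) * (2 * k)"
        using cardL by (intro add_mono mult_le_mono) auto
      also have "\<dots> = 60 * k + 120 * kk" by (simp add: kk_def)
      finally have "card U \<le> 180 * kk" using U(2) kk(1) by linarith
      moreover have "d - card U \<le> card W" unfolding d_def W_def using U by (intro diff_card_le_card_Diff)
      ultimately have W: "d \<le> card W + 180 * kk" by linarith
      \<comment> \<open>Half of the \<open>d\<close> neighbours suffices: the degree sum
        \<open>7 * d\<close> is below \<open>15 * t\<close>, which gives \<open>c = 14\<close>. The
        greedy choice needs \<open>t + 30 * k\<close> vertices, and at most \<open>180 * kk\<close>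
        neighbours are already taken; \<open>d > 500 * kk\<close> covers both.\<close>
      define t where "t = (d + 1) div 2"
      have t: "d \<le> 2 * t" "2 * t \<le> d + 1" by (auto simp: t_def)
      have "\<exists>N\<subseteq>W. card N = 2 * k \<and> (\<forall>u\<in>N. \<forall>w\<in>N. u \<noteq> w \<longrightarrow> \<not> B u w)"
      proof (rule independent_subset[where c = 14 and t = t])
        show "B w u" if "B u w" for u w using that simple_graphD(4)[OF G] by (auto simp: B_def)
        show "finite W" by (simp add: W_def)
        have "(\<Sum>w\<in>W. card {u\<in>W. B w u})
            \<le> (\<Sum>w\<in>W. card {u. u < n \<and> u \<noteq> v \<and> w \<noteq> u \<and> \<not> G w u})"
          using simple_graphD(3)[OF G] by (intro sum_mono card_mono) (auto simp: W_def B_def)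
        also have "\<dots> \<le> (\<Sum>w\<in>{..<n} - {v}. card {u. u < n \<and> u \<noteq> v \<and> w \<noteq> u \<and> \<not> G w u})"
          using simple_graphD(3)[OF G] by (intro sum_mono2) (auto simp: W_def)
        also have "\<dots> \<le> 7 * d" unfolding d_def using v by (intro sparse(2)) (simp add: L_def)
        also have "\<dots> < (14 + 1) * t" using d t by simp
        finally show "(\<Sum>w\<in>W. card {u\<in>W. B w u}) < (14 + 1) * t" .
        show "t + (14 + 1) * (2 * k) \<le> card W" using d t W kk(1,2) by simp
      qed
      then obtain N where N: "N \<subseteq> W" "card N = 2 * k" "\<forall>u\<in>N. \<forall>w\<in>N. u \<noteq> w \<longrightarrow> \<not> B u w" by blast
      have "finite N" using N(1) by (rule finite_subset) (simp add: W_def)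
      then show "\<exists>N. finite N \<and> card N = 2 * k \<and> N \<inter> U = {} \<and> (\<forall>u\<in>N. G v u) \<and>
          (\<forall>u\<in>N. \<forall>w\<in>N. u \<noteq> w \<longrightarrow> G u w)"
        using N by (intro exI[of _ N]) (auto simp: W_def B_def)
    qed
  qed
qed

section \<open>The extremal graph and the conclusion\<close>

lemma simple_graph_H_graph: "simple_graph n (H_graph n m)"
  by (auto simp: simple_graph_def H_graph_def min.commute)

text \<open>The indicator vector of the clique on \<open>n - 1\<close> vertices has Rayleigh
  quotient \<open>n - 2\<close>.\<close>

lemma spec_rad_H_graph_ge:
  assumes "n \<ge> 2"
  shows "real n - 2 \<le> spec_rad n (H_graph n m)"
proof -
  obtain N where N: "n = Suc N" "N \<ge> 1" using assms by (cases n) auto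
  obtain z where z: "\<And>y. quad_form n (H_graph n m) y \<le> spec_rad n (H_graph n m) * (\<Sum>i<n. (y i)\<^sup>2)"
    using spec_rad_maximiser[OF _ simple_graph_H_graph[of n m]] assms
    by (metis not_gr_zero not_numeral_le_zero)
  define y :: "nat \<Rightarrow> real" where "y i = of_bool (i < N)" for i
  have "(\<Sum>i<n. (y i)\<^sup>2) = N" by (simp add: N y_def)
  moreover have "quad_form n (H_graph n m) y = real N * (real N - 1)"
  proof -
    have "quad_form n (H_graph n m) y = (\<Sum>i<N. \<Sum>j<N. of_bool (H_graph n m i j))"
      by (simp add: quad_form_def N y_def)
    also have "\<dots> = (\<Sum>i<N. \<Sum>j<N. 1 - of_bool (j = i))"
      by (intro sum.cong refl) (auto simp: H_graph_def N)
    also have "\<dots> = (\<Sum>i<N. real N - 1)" by (intro sum.cong refl) (simp add: sum_subtractf)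
    finally show ?thesis by simp
  qed
  ultimately show ?thesis using z[of y] N by (simp add: mult.commute)
qed

text \<open>Send \<open>v\<close> to the exceptional vertex \<open>n - 1\<close> and its at most
  \<open>m - 1\<close> neighbours to initial vertices, all adjacent to \<open>n - 1\<close>; the
  rest may go anywhere, since it lands in the clique.\<close>

lemma low_degree_embedding:
  assumes G: "simple_graph n G" and v: "v < n" and deg: "card {u. u < n \<and> G v u} < m"
  obtains f where "bij_betw f {0..<n} {0..<n}" "\<And>i j. G i j \<Longrightarrow> H_graph n m (f i) (f j)"
proof -
  define A where "A = {u. u < n \<and> G v u}"
  have A: "finite A" "v \<notin> A" "card A < m" "A \<subseteq> {0..<n} - {v}"
    using simple_graphD(3)[OF G] deg by (auto simp: A_def)
  have cA: "card A \<le> n - 1" using card_mono[OF _ A(4)] v by simp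
  obtain e where e: "bij_betw e A {..<card A}"
    using A(1) finite_same_card_bij[of A "{..<card A}"] by auto
  have eA: "e u < card A" if "u \<in> A" for u using e that by (auto simp: bij_betw_def)
  define g where "g = e(v := n - 1)"
  have ge: "g u = e u" if "u \<in> A" for u using that A(2) by (auto simp: g_def)
  have "inj_on g A" using e ge by (auto simp: bij_betw_def inj_on_def)
  moreover have "g v \<noteq> g u" if "u \<in> A" for u using eA[OF that] ge[OF that] cA by (simp add: g_def)
  ultimately have "inj_on g (insert v A)" by force
  moreover have "g u < n" if "u \<in> insert v A" for u
    using that eA[of u] ge[of u] cA v by (auto simp: g_def)
  moreover have "insert v A \<subseteq> {0..<n}" using A(4) v by auto
  ultimately obtain f where f: "bij_betw f {0..<n} {0..<n}" "\<And>i. i \<in> insert v A \<Longrightarrow> f i = g i"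
    using bij_betw_extension[OF finite_atLeastLessThan finite_atLeastLessThan refl, of "insert v A" 0 n g]
    by (metis atLeastLessThan_iff image_subsetI zero_le)
  have fv: "f v = n - 1" using f(2)[of v] by (simp add: g_def)
  have fn: "f i < n" if "i < n" for i using f(1) that by (auto simp: bij_betw_def)
  have inj: "f i \<noteq> f j" if "i < n" "j < n" "i \<noteq> j" for i j
    using f(1) that by (auto simp: bij_betw_def inj_on_def)
  have fA: "f u < m - 1" if "u \<in> A" for u using f(2)[of u] ge[OF that] eA[OF that] that A(3) by simp
  have "H_graph n m (f i) (f j)" if "G i j" for i j
  proof -
    note ij = simple_graphD[OF G that]
    have "f i < n - 1 \<and> f j < n - 1 \<or> min (f i) (f j) < m - 1"
    proof (cases "i = v \<or> j = v")
      case True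
      then have "i \<in> A \<or> j \<in> A" using that ij by (auto simp: A_def)
      then show ?thesis using fA by (auto simp: min_less_iff_disj)
    next
      case False
      then show ?thesis using inj[of i v] inj[of j v] fn[OF ij(1)] fn[OF ij(2)] ij v fv by auto
    qed
    then show ?thesis using inj[OF ij(1,2,3)] fn[OF ij(1)] fn[OF ij(2)] by (simp add: H_graph_def)
  qed
  with f(1) show thesis by (rule that)
qed

theorem theorem5p1:
  fixes k :: nat
  assumes "k \<ge> 1"
  shows "\<exists>n0::nat. \<forall>n G. n \<ge> max ((80 * k)^2) n0 \<longrightarrow> simple_graph n G \<longrightarrow>
           \<not> contains_subgraph n G n (cycle_power n k) \<longrightarrow>
           spec_rad n G \<le> spec_rad n (H_graph n (2 * k)) \<and>
           (spec_rad n G = spec_rad n (H_graph n (2 * k)) \<longleftrightarrow> graph_iso n G (H_graph n (2 * k)))"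
proof (intro exI[of _ "1000000 * k ^ 4"] allI impI)
  fix n G
  assume "max ((80 * k)\<^sup>2) (1000000 * k ^ 4) \<le> n" and G: "simple_graph n G"
    and free: "\<not> contains_subgraph n G n (cycle_power n k)"
  then have n: "1000000 * k ^ 4 \<le> n" by simp
  moreover have "1 \<le> k ^ 4" using assms by simp
  ultimately have n3: "n \<ge> 3" by linarith
  let ?H = "H_graph n (2 * k)"
  have H: "simple_graph n ?H" by (rule simple_graph_H_graph)
  have rhoH: "real n - 2 \<le> spec_rad n ?H" using n3 by (intro spec_rad_H_graph_ge) simp
  \<comment> \<open>Assuming only this inequality settles both claims: a graph \<open>G\<close> of
    larger spectral radius would be isomorphic to \<open>?H\<close>, and then the two radii would
    agree.\<close>
  have iso: "graph_iso n G ?H" if le: "spec_rad n ?H \<le> spec_rad n G"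
  proof -
    obtain v where v: "v < n" "card {u. u < n \<and> G v u} < 2 * k"
      using contains_cycle_power_of_spec_rad[OF G assms n] free rhoH le
      by (meson not_le order_trans)
    obtain f where f: "bij_betw f {0..<n} {0..<n}" "\<And>i j. G i j \<Longrightarrow> ?H (f i) (f j)"
      using low_degree_embedding[OF G v] by blast
    have "G i j" if "i < n" "j < n" "?H (f i) (f j)" for i j
    proof (rule spec_rad_strict_mono_embedding[OF _ G H f le, where c = 0])
      \<comment> \<open>Vertex 0 dominates because \<open>k \<ge> 1\<close> gives
        \<open>0 < 2 * k - 1\<close>.\<close>
      show "?H 0 j" if "j < n" "j \<noteq> 0" for j using that assms by (auto simp: H_graph_def)
    qed (use that n3 rhoH in auto)
    then show ?thesis unfolding graph_iso_def using f by blast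
  qed
  have "spec_rad n G = spec_rad n ?H" if "graph_iso n G ?H"
    using that n3 by (intro spec_rad_iso G H) auto
  then show "spec_rad n G \<le> spec_rad n ?H \<and> (spec_rad n G = spec_rad n ?H \<longleftrightarrow> graph_iso n G ?H)"
    using iso by (metis linear order_refl)
qed

end
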